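(* Let $p$ be an odd prime and let $\widetilde{AG}(2,p^2)=\bigcup_{i=0}^4\mathcal B_i$ be the block design on $(\mathbb Z_p^2)^2$ defined below. Then $\widetilde{AG}(2,p^2)$ is a simple, non-affine balanced incomplete block design; it is not decomposable into a union of $p+1$ balanced incomplete block designs isomorphic to $AG(2,p^2)$; and any two blocks $\beta,\beta'\in\widetilde{AG}(2,p^2)$ satisfy $|\beta\cap\beta'|\in\{p^2,p,1,0\}$.
   Context: Points of $(\mathbb Z_p^2)^2$ are written $(k,\kappa)$, $k=(k_0,k_1)$, $\kappa=(\kappa_0,\kappa_1)$. $\mathcal B_0=\{\{(k,\kappa):\kappa\in\mathbb Z_p^2\}:k\in\mathbb Z_p^2\}$; $\mathcal B_1=\{\{(k,Ak+b):k\in\mathbb Z_p^2\}:A\in\mathrm{Sym}_2(\mathbb Z_p),b\in\mathbb Z_p^2\}$; $\mathcal B_2=\{\{((c_0,k_1),(\kappa_0,ak_1+b)):k_1,\kappa_0\in\mathbb Z_p\}:a,b,c_0\in\mathbb Z_p\}$; $\mathcal B_3=\{\{((k_0,c_1),(ak_0+b,\kappa_1)):k_0,\kappa_1\in\mathbb Z_p\}:a,b,c_1\in\mathbb Z_p\}$; $\mathcal B_4=\{\{((k_0,\alpha k_0+\beta),(\kappa_0,(-1/\alpha)\kappa_0+ak_0+b)):k_0,\kappa_0\in\mathbb Z_p\}:\alpha,\beta,a,b\in\mathbb Z_p,\alpha\ne0\}$. A $(v,k,\lambda)$-BIBD is a collection of $k$-subsets (blocks) of a $v$-set with every pair of distinct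 points in exactly $\lambda$ blocks; it is simple if no block is repeated; it is affine if its blocks can be partitioned into parallel classes, each partitioning the point set, with a constant $\mu\in\mathbb N$ such that blocks from different classes meet in exactly $\mu$ points. $AG(2,p^2)$ is the design of affine lines of the plane $GF(p^2)^2$, a $(p^4,p^2,1)$-BIBD. *)

theory Defs
  imports
    "HOL-Analysis.Cartesian_Space"
    "HOL-Library.Multiset"
    "HOL-Library.Disjoint_Sets"
    "Berlekamp_Zassenhaus.Finite_Field"
begin

text \<open>
  A block collection is a multiset of point sets, so that repeated blocks are meaningful.
\<close>

type_synonym 'a blocks = "'a set multiset"

definition bibd :: "nat \<Rightarrow> nat \<Rightarrow> nat \<Rightarrow> 'a set \<Rightarrow> 'a blocks \<Rightarrow> bool" where
  "bibd v k l V B \<longleftrightarrow>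
     finite V \<and> card V = v \<and>
     (\<forall>\<beta>\<in>#B. \<beta> \<subseteq> V \<and> card \<beta> = k) \<and>
     (\<forall>x\<in>V. \<forall>y\<in>V. x \<noteq> y \<longrightarrow> size {#\<beta> \<in># B. x \<in> \<beta> \<and> y \<in> \<beta>#} = l)"

definition is_bibd :: "'a set \<Rightarrow> 'a blocks \<Rightarrow> bool" where
  "is_bibd V B \<longleftrightarrow> (\<exists>v k l. bibd v k l V B)"

definition simple_design :: "'a blocks \<Rightarrow> bool" where
  "simple_design B \<longleftrightarrow> (\<forall>\<beta>\<in>#B. count B \<beta> = 1)"

text \<open>
  The parallel classes are \<open>C 0, \<dots>, C (n - 1)\<close>.  Blocks within one class are disjoint and
  nonempty, so a class is a set of blocks; equal blocks of \<open>B\<close> must lie in different classes.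
\<close>

definition affine_design :: "'a set \<Rightarrow> 'a blocks \<Rightarrow> bool" where
  "affine_design V B \<longleftrightarrow>
     (\<exists>(n::nat) (C :: nat \<Rightarrow> 'a set set) (\<mu>::nat).
        B = (\<Sum>i<n. mset_set (C i)) \<and>
        (\<forall>i<n. partition_on V (C i)) \<and>
        (\<forall>i<n. \<forall>j<n. i \<noteq> j \<longrightarrow> (\<forall>\<beta>\<in>C i. \<forall>\<beta>'\<in>C j. card (\<beta> \<inter> \<beta>') = \<mu>)))"

definition design_iso :: "'a set \<Rightarrow> 'a blocks \<Rightarrow> 'b set \<Rightarrow> 'b blocks \<Rightarrow> bool" where
  "design_iso V B W C \<longleftrightarrow> (\<exists>f. bij_betw f V W \<and> image_mset ((`) f) B = C)"

text \<open>\<open>B\<close> is the union of \<open>n\<close> BIBDs on \<open>V\<close>, each isomorphic to the design \<open>(W, C)\<close>.\<close>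

definition decomposes_into_copies :: "'a set \<Rightarrow> 'a blocks \<Rightarrow> nat \<Rightarrow> 'b set \<Rightarrow> 'b blocks \<Rightarrow> bool" where
  "decomposes_into_copies V B n W C \<longleftrightarrow>
     (\<exists>D :: nat \<Rightarrow> 'a blocks.
        B = (\<Sum>i<n. D i) \<and> (\<forall>i<n. is_bibd V (D i) \<and> design_iso V (D i) W C))"

text \<open>
  The affine lines of the plane over a finite field \<open>'q\<close>; this is \<open>AG(2, p\<^sup>2)\<close> when \<open>'q\<close> has
  \<open>p\<^sup>2\<close> elements, i.e. when \<open>'q\<close> is \<open>GF(p\<^sup>2)\<close>.
\<close>

definition AG2 :: "('q::{field,finite} \<times> 'q) blocks" where
  "AG2 = mset_set {range (\<lambda>t. (x + t * u, y + t * v)) | x y u v. (u, v) \<noteq> (0, 0)}"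

text \<open>
  \<open>'p mod_ring\<close> is the ring of integers modulo \<open>CARD('p)\<close>, and \<open>'p::prime_card\<close> says that
  this cardinality is prime.  Each family below contributes one block for every choice of its
  parameters.
\<close>

type_synonym 'p point = "('p mod_ring ^ 2) \<times> ('p mod_ring ^ 2)"

definition Sym2 :: "('p::prime_card mod_ring ^ 2 ^ 2) set" where
  "Sym2 = {A. transpose A = A}"

definition \<B>0 :: "'p::prime_card point blocks" where
  "\<B>0 = {# {(k, \<kappa>) | \<kappa>. True}. k \<in># mset_set UNIV #}"

definition \<B>1 :: "'p::prime_card point blocks" where
  "\<B>1 = {# {(k, A *v k + b) | k. True}. (A, b) \<in># mset_set (Sym2 \<times> UNIV) #}"

definition \<B>2 :: "'p::prime_card point blocks" where
  "\<B>2 = {# {(vector [c\<^sub>0, k\<^sub>1], vector [\<kappa>\<^sub>0, a * k\<^sub>1 + b]) | k\<^sub>1 \<kappa>\<^sub>0. True}.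
          (a, b, c\<^sub>0) \<in># mset_set UNIV #}"

definition \<B>3 :: "'p::prime_card point blocks" where
  "\<B>3 = {# {(vector [k\<^sub>0, c\<^sub>1], vector [a * k\<^sub>0 + b, \<kappa>\<^sub>1]) | k\<^sub>0 \<kappa>\<^sub>1. True}.
          (a, b, c\<^sub>1) \<in># mset_set UNIV #}"

definition \<B>4 :: "'p::prime_card point blocks" where
  "\<B>4 = {# {(vector [k\<^sub>0, \<alpha> * k\<^sub>0 + \<beta>], vector [\<kappa>\<^sub>0, (- 1 / \<alpha>) * \<kappa>\<^sub>0 + a * k\<^sub>0 + b]) | k\<^sub>0 \<kappa>\<^sub>0. True}.
          (\<alpha>, \<beta>, a, b) \<in># mset_set {(\<alpha>, \<beta>, a, b). \<alpha> \<noteq> 0} #}"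

text \<open>
  The union keeps multiplicities, so simplicity includes that distinct parameters give distinct
  blocks and that the five families are disjoint.
\<close>

definition AG_tilde :: "'p::prime_card point blocks" where
  "AG_tilde = \<B>0 + \<B>1 + \<B>2 + \<B>3 + \<B>4"

end

theory Submission
  imports Defs
begin

text \<open>
  For the symplectic form \<open>\<omega>((k,\<kappa>),(l,\<lambda>)) = k\<cdot>\<lambda> - \<kappa>\<cdot>l\<close> the blocks are exactly the cosets of
  the \<open>(p + 1)(p\<^sup>2 + 1)\<close> Lagrangian planes.  The blocks through \<open>0\<close> of a copy of \<open>AG(2, p\<^sup>2)\<close> would
  form a spread: \<open>p\<^sup>2 + 1\<close> Lagrangian planes partitioning the nonzero vectors.  Non-decomposability
  follows because two spreads always share a plane when \<open>p\<close> is an odd prime.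

  Lagrangian planes are the points of a quadric in \<open>PG(4, p)\<close>, whose hyperplanes are the alternating
  forms \<open>h\<close> modulo \<open>\<omega>\<close>; let \<open>N h\<close> count the members of a spread on which \<open>h\<close> vanishes.  If some
  \<open>h - \<lambda>\<omega>\<close> is degenerate, its radical is a plane, and intersecting it with the spread gives
  \<open>N h \<equiv> 1\<close> modulo \<open>p\<close> and \<open>N h \<le> p + 1\<close>.  The power sum of the values of \<open>h\<close> to the exponent \<open>p - 1\<close>
  is a polynomial of degree \<open>p - 1\<close> in \<open>h\<close> which vanishes in these cases, and this forces it to be
  identically zero; so \<open>N h \<equiv> 1\<close> for all \<open>h\<close>.  Since the
  first three moments of \<open>N\<close> are known, \<open>N\<close> takes only the values \<open>1\<close>, \<open>p + 1\<close>, \<open>p\<^sup>2 + 1\<close>, and some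
  \<open>h \<noteq> 0\<close> vanishes on the whole spread.  This \<open>h\<close> has no degenerate translate, so each nonzero vector
  lies in only one Lagrangian plane on which \<open>h\<close> vanishes, and that plane belongs to the spread; but
  \<open>h\<close> also vanishes on a plane of the other spread, as \<open>N h \<equiv> 1\<close> there too.
\<close>

section \<open>Alternating forms on a four-dimensional space\<close>

text \<open>Every fibre is a translate of the kernel. Here this takes the place of rank-nullity, for
  spaces of points as well as for spaces of forms.\<close>

lemma card_kernel:
  fixes f :: "'a::{ab_group_add,finite} \<Rightarrow> 'b::{ab_group_add,finite}"
  assumes add: "\<And>x y. f (x + y) = f x + f y" and surj: "\<And>y. \<exists>x. f x = y"
  shows "CARD('a) = card {x. f x = 0} * CARD('b)"
proof -
  have minus: "f (x - y) = f x - f y" for x y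
    using add[of "x - y" y] by (simp add: algebra_simps)
  have fib: "card {x. f x = y} = card {x. f x = 0}" for y
  proof -
    obtain x0 where x0: "f x0 = y" using surj by blast
    have "bij_betw (\<lambda>x. x + x0) {x. f x = 0} {x. f x = y}"
      by (rule bij_betwI[where g = "\<lambda>x. x - x0"])
        (use x0 add minus in auto)
    then show ?thesis by (simp add: bij_betw_same_card)
  qed
  have "CARD('a) = card (\<Union>y. {x. f x = y})" by (rule arg_cong[where f = card]) auto
  also have "\<dots> = (\<Sum>y\<in>UNIV. card {x. f x = y})"
    by (rule card_UN_disjoint) auto
  also have "\<dots> = (\<Sum>y\<in>(UNIV::'b set). card {x. f x = 0})" by (rule sum.cong[OF refl]) (rule fib)
  finally show ?thesis by simp
qed

text \<open>Lagrange's theorem for sets closed under subtraction: the classes of \<open>?r\<close>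
  are cosets of \<open>S\<close> in \<open>T\<close>. It restricts how planes can intersect.\<close>

lemma card_subgroup_dvd:
  fixes S T :: "'a::{ab_group_add,finite} set"
  assumes "S \<subseteq> T" "0 \<in> S" and S: "\<And>x y. x \<in> S \<Longrightarrow> y \<in> S \<Longrightarrow> x - y \<in> S"
    and T: "\<And>x y. x \<in> T \<Longrightarrow> y \<in> T \<Longrightarrow> x - y \<in> T"
  shows "card S dvd card T"
proof (rule equiv_imp_dvd_card)
  let ?r = "{(x, y). x \<in> T \<and> y \<in> T \<and> x - y \<in> S}"
  have minus: "- x \<in> S" if "x \<in> S" for x using S[OF \<open>0 \<in> S\<close> that] by simp
  have plus: "x + y \<in> S" if "x \<in> S" "y \<in> S" for x y using S[OF that(1) minus[OF that(2)]] by simp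
  have sym: "y - x \<in> S" if "x - y \<in> S" for x y using minus[OF that] by simp
  have trans: "x - z \<in> S" if "x - y \<in> S" "y - z \<in> S" for x y z using plus[OF that] by simp
  show eq: "equiv T ?r"
    by (rule equivI) (use \<open>0 \<in> S\<close> in \<open>auto simp: refl_on_def intro!: symI transI dest: sym intro: trans\<close>)
  fix X assume "X \<in> T // ?r"
  then obtain x where x: "x \<in> T" "X = ?r `` {x}" by (auto elim: quotientE)
  have Tm: "x + s \<in> T" if "s \<in> S" for s
  proof -
    have "- s \<in> T" using minus[OF that] \<open>S \<subseteq> T\<close> by auto
    from T[OF x(1) this] show ?thesis by simp
  qed
  have "bij_betw (\<lambda>s. x + s) S X"
    by (rule bij_betwI[where g = "\<lambda>y. y - x"]) (use x Tm minus sym in auto)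
  from bij_betw_same_card[OF this] show "card S dvd card X" by simp
qed simp

type_synonym 'a pt = "('a ^ 2) \<times> ('a ^ 2)"

definition smul :: "'a::field \<Rightarrow> 'a pt \<Rightarrow> 'a pt" where
  "smul c x = (c *s fst x, c *s snd x)"

definition comb :: "'a::field pt \<Rightarrow> 'a pt \<Rightarrow> 'a \<Rightarrow> 'a \<Rightarrow> 'a pt" where
  "comb a b c d = smul c a + smul d b"

definition indep :: "'a::field pt \<Rightarrow> 'a pt \<Rightarrow> bool" where
  "indep a b \<longleftrightarrow> (\<forall>c d. comb a b c d = 0 \<longrightarrow> c = 0 \<and> d = 0)"

definition span2 :: "'a::field pt \<Rightarrow> 'a pt \<Rightarrow> 'a pt set" where
  "span2 a b = {comb a b c d | c d. True}"

lemma pt_eq_iff: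
  fixes x y :: "'a pt"
  shows "x = y \<longleftrightarrow> fst x $ 1 = fst y $ 1 \<and> fst x $ 2 = fst y $ 2 \<and> snd x $ 1 = snd y $ 1 \<and> snd x $ 2 = snd y $ 2"
  by (auto simp: prod_eq_iff vec_eq_iff forall_2)

lemma comb_simps:
  "fst (comb a b c d) = c *s fst a + d *s fst b"
  "snd (comb a b c d) = c *s snd a + d *s snd b"
  by (simp_all add: comb_def smul_def)

lemma comb_algebra:
  "comb a b 0 0 = 0" "comb a b 1 0 = a" "comb a b 0 1 = b"
  "comb a b c d - comb a b c' d' = comb a b (c - c') (d - d')"
  by (simp_all add: pt_eq_iff comb_simps algebra_simps)

lemma zero_in_span2: "0 \<in> span2 a b"
  unfolding span2_def using comb_algebra(1)[of a b] by (metis (mono_tags, lifting) mem_Collect_eq)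

lemma generators_in_span2: "a \<in> span2 a b" "b \<in> span2 a b"
  unfolding span2_def using comb_algebra(2,3)[of a b] by (metis (mono_tags, lifting) mem_Collect_eq)+

lemma diff_in_span2: "x \<in> span2 a b \<Longrightarrow> y \<in> span2 a b \<Longrightarrow> x - y \<in> span2 a b"
  unfolding span2_def using comb_algebra(4)[of a b] by (smt (verit) mem_Collect_eq)

lemma card_span2:
  fixes a b :: "'a::{field,finite} pt"
  assumes "indep a b"
  shows "card (span2 a b) = CARD('a) ^ 2"
proof -
  have "inj (\<lambda>(c, d). comb a b c d)"
  proof (rule injI, clarify)
    fix c d c' d' assume "comb a b c d = comb a b c' d'"
    then have "comb a b (c - c') (d - d') = 0"
      by (simp add: comb_algebra(4)[symmetric])
    with assms show "c = c' \<and> d = d'" unfolding indep_def by fastforce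
  qed
  moreover have "span2 a b = range (\<lambda>(c, d). comb a b c d)"
    unfolding span2_def by (simp add: set_eq_iff image_iff)
  ultimately show ?thesis by (simp add: card_image power2_eq_square)
qed

lemma CARD_pt: "CARD('a::finite pt) = CARD('a) ^ 4"
  by (simp add: power_add[symmetric])

section \<open>Alternating forms, their radicals and the planes on which they vanish\<close>

definition alt_form :: "('a::field pt \<Rightarrow> 'a pt \<Rightarrow> 'a) \<Rightarrow> bool" where
  "alt_form H \<longleftrightarrow> (\<forall>x y z. H (x + y) z = H x z + H y z) \<and> (\<forall>c x z. H (smul c x) z = c * H x z)
     \<and> (\<forall>x. H x x = 0) \<and> (\<forall>x y. H y x = - H x y)"

text \<open>Such an \<open>H\<close> is, up to the factor \<open>H e f\<close>, the wedge product of \<open>H e\<close> and \<open>H f\<close>.\<close>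

definition rank_two_form :: "('a::field pt \<Rightarrow> 'a pt \<Rightarrow> 'a) \<Rightarrow> 'a pt \<Rightarrow> 'a pt \<Rightarrow> bool" where
  "rank_two_form H e f \<longleftrightarrow> H e f \<noteq> 0 \<and> (\<forall>x y. H e f * H x y = H e x * H f y - H e y * H f x)"

definition rad :: "('a::field pt \<Rightarrow> 'a pt \<Rightarrow> 'a) \<Rightarrow> 'a pt set" where
  "rad H = {x. \<forall>y. H x y = 0}"

definition vanishes_on :: "('a::field pt \<Rightarrow> 'a pt \<Rightarrow> 'a) \<Rightarrow> 'a pt set \<Rightarrow> bool" where
  "vanishes_on H L \<longleftrightarrow> (\<forall>x\<in>L. \<forall>y\<in>L. H x y = 0)"

lemma alt_formD:
  assumes "alt_form H"
  shows "H (x + y) z = H x z + H y z" "H (smul c x) z = c * H x z" "H x x = 0" "H y x = - H x y"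
  using assms unfolding alt_form_def by blast+

lemma alt_form_comb:
  assumes "alt_form H"
  shows "H (comb a b c d) z = c * H a z + d * H b z" "H z (comb a b c d) = c * H z a + d * H z b"
proof -
  show 1: "H (comb a b c d) z = c * H a z + d * H b z" for z
    unfolding comb_def using alt_formD(1,2)[OF assms] by simp
  have "H z (comb a b c d) = - H (comb a b c d) z" "H a z = - H z a" "H b z = - H z b"
    using assms unfolding alt_form_def by blast+
  with 1[of z] show "H z (comb a b c d) = c * H z a + d * H z b" by simp
qed

text \<open>On two combinations of \<open>a\<close> and \<open>b\<close> the form equals
  \<open>H a b\<close> times the determinant of the coefficients, so a single value decides.\<close>

lemma vanishes_on_span2_iff:
  assumes "alt_form H"
  shows "vanishes_on H (span2 a b) \<longleftrightarrow> H a b = 0"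
proof
  assume "vanishes_on H (span2 a b)" then show "H a b = 0" using generators_in_span2 unfolding vanishes_on_def by blast
next
  assume "H a b = 0"
  moreover have "H a a = 0" "H b b = 0" "H b a = - H a b" using assms unfolding alt_form_def by blast+
  ultimately show "vanishes_on H (span2 a b)" unfolding vanishes_on_def span2_def
    by (auto simp: alt_form_comb[OF assms] simp del: split_paired_All)
qed

lemma rad_eq:
  assumes "alt_form H" "rank_two_form H e f"
  shows "rad H = {x. H e x = 0 \<and> H f x = 0}"
proof -
  have sk: "H y x = - H x y" for x y using assms(1) unfolding alt_form_def by blast
  have "H x y = 0" if "H e x = 0" "H f x = 0" for x y
  proof -
    have "H e f * H x y = H e x * H f y - H e y * H f x" "H e f \<noteq> 0"
      using assms(2) unfolding rank_two_form_def by blast+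
    with that show ?thesis by simp
  qed
  then show ?thesis unfolding rad_def using sk[of _ e] sk[of _ f] by (intro Collect_cong) (metis neg_equal_0_iff_equal)
qed

lemma cramer:
  fixes a b c d u v :: "'a::field"
  assumes "D = a * d - b * c" "D \<noteq> 0"
  shows "(u * d - v * b) / D * a + (v * a - u * c) / D * b = u"
    "(u * d - v * b) / D * c + (v * a - u * c) / D * d = v"
proof -
  have "(u * d - v * b) / D * a + (v * a - u * c) / D * b = (u * D) / D"
    unfolding assms(1) by (simp add: add_divide_distrib[symmetric] algebra_simps)
  then show "(u * d - v * b) / D * a + (v * a - u * c) / D * b = u" using assms(2) by simp
  have "(u * d - v * b) / D * c + (v * a - u * c) / D * d = (v * D) / D"
    unfolding assms(1) by (simp add: add_divide_distrib[symmetric] algebra_simps)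
  then show "(u * d - v * b) / D * c + (v * a - u * c) / D * d = v" using assms(2) by simp
qed

definition lin_form :: "('a::field pt \<Rightarrow> 'a) \<Rightarrow> bool" where
  "lin_form u \<longleftrightarrow> (\<forall>x y. u (x + y) = u x + u y) \<and> (\<forall>c x. u (smul c x) = c * u x)"

lemma lin_formD:
  assumes "lin_form u"
  shows "u (x + y) = u x + u y" "u (comb a b c d) = c * u a + d * u b"
proof -
  have 1: "u (x + y) = u x + u y" "u (smul c x) = c * u x" for x y c
    using assms unfolding lin_form_def by blast+
  show "u (x + y) = u x + u y" "u (comb a b c d) = c * u a + d * u b"
    unfolding comb_def 1 by (rule refl)+
qed

lemma alt_form_lin:
  assumes "alt_form H"
  shows "lin_form (\<lambda>x. H x z)" "lin_form (H z)"
proof -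
  have skew: "H y x = - H x y" for x y by (rule alt_formD(4)[OF assms])
  have 1: "H (x + y) z = H x z + H y z" "H (smul c x) z = c * H x z" for x y c z
    by (rule alt_formD[OF assms])+
  have 2: "H z (x + y) = H z x + H z y" "H z (smul c x) = c * H z x" for x y c
    using skew[of z "x + y"] skew[of z x] skew[of z y] skew[of z "smul c x"] 1(1)[of x y z] 1(2)[of c x z]
    by simp_all
  from 1 2 show "lin_form (\<lambda>x. H x z)" "lin_form (H z)" unfolding lin_form_def by blast+
qed

text \<open>The nonzero determinant makes \<open>y\<close> to \<open>(u y, v y)\<close> surjective
  by Cramer's rule, so its kernel has \<open>q ^ 4 / q ^ 2\<close> elements, \<open>q\<close> being
  the order of the field.\<close>

lemma card_common_zeros:
  fixes u v :: "'a::{field,finite} pt \<Rightarrow> 'a"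
  assumes "lin_form u" "lin_form v" "u e * v f \<noteq> u f * v e"
  shows "card {y. u y = 0 \<and> v y = 0} = CARD('a) ^ 2"
proof -
  let ?f = "\<lambda>y. (u y, v y)"
  have add: "?f (y + z) = ?f y + ?f z" for y z
    by (simp only: lin_formD(1)[OF assms(1)] lin_formD(1)[OF assms(2)] add_Pair)
  define D where "D = u e * v f - u f * v e"
  have D: "D \<noteq> 0" using assms(3) by (simp add: D_def)
  have surj: "\<exists>y. ?f y = s" for s
  proof -
    obtain r t where s: "s = (r, t)" by force
    let ?y = "comb e f ((r * v f - t * u f) / D) ((t * u e - r * v e) / D)"
    have "u ?y = r" "v ?y = t"
      unfolding lin_formD(2)[OF assms(1)] lin_formD(2)[OF assms(2)] by (rule cramer[OF D_def D])+
    then show ?thesis using s by blast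
  qed
  have "CARD('a pt) = card {y. ?f y = 0} * CARD('a \<times> 'a)"
    by (rule card_kernel[of ?f, OF add surj])
  then have "CARD('a) ^ 4 = card {y. ?f y = 0} * CARD('a) ^ 2"
    unfolding CARD_pt by (simp only: card_prod power2_eq_square)
  moreover have "CARD('a) ^ 4 = CARD('a) ^ 2 * CARD('a) ^ 2" by (simp add: power_add[symmetric])
  ultimately have "card {y. ?f y = 0} * CARD('a) ^ 2 = CARD('a) ^ 2 * CARD('a) ^ 2" by metis
  moreover have "CARD('a) ^ 2 \<noteq> 0" by simp
  ultimately have "card {y. ?f y = 0} = CARD('a) ^ 2" using mult_right_cancel by blast
  then show ?thesis by (simp only: zero_prod_def prod.inject)
qed

text \<open>The radical is cut out by \<open>H e\<close> and \<open>H f\<close>, and these are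
  independent: evaluated at \<open>e\<close> and \<open>f\<close> themselves, they have determinant
  \<open>(H e f)\<^sup>2\<close>.\<close>

lemma card_rad:
  fixes H :: "'a::{field,finite} pt \<Rightarrow> 'a pt \<Rightarrow> 'a"
  assumes "alt_form H" "rank_two_form H e f"
  shows "card (rad H) = CARD('a) ^ 2"
proof -
  have "H e e = 0" "H f e = - H e f" by (rule alt_formD[OF assms(1)])+
  then have "H e e * H f f \<noteq> H e f * H f e" using assms(2) unfolding rank_two_form_def by simp
  from card_common_zeros[OF alt_form_lin(2)[OF assms(1)] alt_form_lin(2)[OF assms(1)] this]
  show ?thesis unfolding rad_eq[OF assms] .
qed

text \<open>\<open>H\<close> is, up to a nonzero factor, the determinant of the map \<open>x\<close>
  to \<open>(H e x, H f x)\<close>, whose kernel is the radical. So \<open>H a b = 0\<close> says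
  that this map is not injective on the plane.\<close>

lemma vanishes_on_span2_iff_meets_rad:
  assumes H: "alt_form H" "rank_two_form H e f" and ab: "indep a b"
  shows "vanishes_on H (span2 a b) \<longleftrightarrow> (\<exists>x\<in>span2 a b \<inter> rad H. x \<noteq> 0)"
proof
  assume "vanishes_on H (span2 a b)"
  then have "H a b = 0" using vanishes_on_span2_iff[OF H(1)] by blast
  moreover have "H e f * H a b = H e a * H f b - H e b * H f a"
    using H(2) unfolding rank_two_form_def by blast
  ultimately have eq: "H e a * H f b = H e b * H f a" by simp
  \<comment> \<open>It suffices to find a nontrivial combination killed by \<open>H e\<close> and
    \<open>H f\<close>. As the two rows \<open>(H e a, H e b)\<close> and
    \<open>(H f a, H f b)\<close> are proportional, the coefficients are read off from whichever row
    is nonzero.\<close>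
  have *: "\<exists>x\<in>span2 a b \<inter> rad H. x \<noteq> 0"
    if "H e (comb a b c d) = 0" "H f (comb a b c d) = 0" "c \<noteq> 0 \<or> d \<noteq> 0" for c d
  proof
    show "comb a b c d \<in> span2 a b \<inter> rad H"
      using that(1,2) unfolding rad_eq[OF H] span2_def by blast
    show "comb a b c d \<noteq> 0" using ab that(3) unfolding indep_def by blast
  qed
  show "\<exists>x\<in>span2 a b \<inter> rad H. x \<noteq> 0"
  proof (cases "H e a = 0 \<and> H e b = 0")
    case True
    show ?thesis
    proof (cases "H f a = 0 \<and> H f b = 0")
      case True
      with \<open>H e a = 0 \<and> H e b = 0\<close> show ?thesis
        by (intro *[of 1 0]) (simp_all add: alt_form_comb[OF H(1)])
    next
      case False
      with True show ?thesis
        by (intro *[of "H f b" "- H f a"]) (auto simp: alt_form_comb[OF H(1)])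
    qed
  next
    case False
    with eq show ?thesis
      by (intro *[of "H e b" "- H e a"]) (auto simp: alt_form_comb[OF H(1)] algebra_simps)
  qed
next
  assume "\<exists>x\<in>span2 a b \<inter> rad H. x \<noteq> 0"
  then obtain x where x: "x \<in> span2 a b" "x \<in> rad H" "x \<noteq> 0" by blast
  then obtain c d where cd: "x = comb a b c d" unfolding span2_def by blast
  have "c \<noteq> 0 \<or> d \<noteq> 0" using x(3) cd comb_algebra(1) by metis
  moreover have "H x a = 0" "H x b = 0" using x(2) unfolding rad_def by blast+
  moreover have "H a a = 0" "H b b = 0" "H b a = - H a b" by (rule alt_formD[OF H(1)])+
  ultimately have "H a b = 0" unfolding cd by (auto simp: alt_form_comb[OF H(1)])
  then show "vanishes_on H (span2 a b)" using vanishes_on_span2_iff[OF H(1)] by blast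
qed

section \<open>Spreads of Lagrangian planes\<close>

text \<open>Pluecker coordinates; the indices 0, 1, 2, 3 stand for the components \<open>k\<^sub>0\<close>, \<open>k\<^sub>1\<close>, \<open>\<kappa>\<^sub>0\<close>, \<open>\<kappa>\<^sub>1\<close> of a point.\<close>

definition pl01 :: "'a::field pt \<Rightarrow> 'a pt \<Rightarrow> 'a" where
  "pl01 x y = fst x $ 1 * fst y $ 2 - fst x $ 2 * fst y $ 1"
definition pl02 :: "'a::field pt \<Rightarrow> 'a pt \<Rightarrow> 'a" where
  "pl02 x y = fst x $ 1 * snd y $ 1 - snd x $ 1 * fst y $ 1"
definition pl03 :: "'a::field pt \<Rightarrow> 'a pt \<Rightarrow> 'a" where
  "pl03 x y = fst x $ 1 * snd y $ 2 - snd x $ 2 * fst y $ 1"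
definition pl12 :: "'a::field pt \<Rightarrow> 'a pt \<Rightarrow> 'a" where
  "pl12 x y = fst x $ 2 * snd y $ 1 - snd x $ 1 * fst y $ 2"
definition pl13 :: "'a::field pt \<Rightarrow> 'a pt \<Rightarrow> 'a" where
  "pl13 x y = fst x $ 2 * snd y $ 2 - snd x $ 2 * fst y $ 2"
definition pl23 :: "'a::field pt \<Rightarrow> 'a pt \<Rightarrow> 'a" where
  "pl23 x y = snd x $ 1 * snd y $ 2 - snd x $ 2 * snd y $ 1"

lemmas pl_defs = pl01_def pl02_def pl03_def pl12_def pl13_def pl23_def

definition omega :: "'a::field pt \<Rightarrow> 'a pt \<Rightarrow> 'a" where
  "omega x y = pl02 x y + pl13 x y"

definition form6 :: "'a::field \<Rightarrow> 'a \<Rightarrow> 'a \<Rightarrow> 'a \<Rightarrow> 'a \<Rightarrow> 'a \<Rightarrow> 'a pt \<Rightarrow> 'a pt \<Rightarrow> 'a" where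
  "form6 h01 h02 h03 h12 h13 h23 x y =
     h01 * pl01 x y + h02 * pl02 x y + h03 * pl03 x y + h12 * pl12 x y + h13 * pl13 x y + h23 * pl23 x y"

lemma alt_form_form6: "alt_form (form6 h01 h02 h03 h12 h13 h23)"
  unfolding alt_form_def form6_def pl_defs smul_def
  by (simp add: algebra_simps)

lemma form6_omega: "omega = form6 0 1 0 0 1 0"
  by (intro ext) (simp add: omega_def form6_def)

text \<open>The quantity in \<open>pf\<close> is the Pfaffian of the form.\<close>

lemma rank_two_form6:
  assumes pf: "h01 * h23 - h02 * h13 + h03 * h12 = 0"
    and nz: "(h01, h02, h03, h12, h13, h23) \<noteq> (0, 0, 0, 0, 0, 0)"
  shows "\<exists>e f. rank_two_form (form6 h01 h02 h03 h12 h13 h23) e f"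
proof -
  let ?H = "form6 h01 h02 h03 h12 h13 h23"
  define e0 e1 e2 e3 :: "'a pt" where e: "e0 = (vector [1, 0], vector [0, 0])" "e1 = (vector [0, 1], vector [0, 0])"
    "e2 = (vector [0, 0], vector [1, 0])" "e3 = (vector [0, 0], vector [0, 1])"
  have H: "?H e0 x = h01 * fst x $ 2 + h02 * snd x $ 1 + h03 * snd x $ 2"
    "?H e1 x = - h01 * fst x $ 1 + h12 * snd x $ 1 + h13 * snd x $ 2"
    "?H e2 x = - h02 * fst x $ 1 - h12 * fst x $ 2 + h23 * snd x $ 2"
    "?H e3 x = - h03 * fst x $ 1 - h13 * fst x $ 2 - h23 * snd x $ 1" for x
    by (simp_all add: e form6_def pl_defs)
  have basis: "?H e0 e1 = h01" "?H e0 e2 = h02" "?H e0 e3 = h03" "?H e1 e2 = h12" "?H e1 e3 = h13" "?H e2 e3 = h23"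
    unfolding H by (simp_all add: e)
  \<comment> \<open>The Pfaffian relation as rewrite rules, in the two shapes that products take
    after \<open>algebra_simps\<close>.\<close>
  have pf': "h02 * h13 = h01 * h23 + h03 * h12" using pf by (simp add: algebra_simps)
  have pf'': "h02 * (h13 * c) = h01 * (h23 * c) + h03 * (h12 * c)" for c
  proof -
    have "(h02 * h13) * c = (h01 * h23 + h03 * h12) * c" by (simp only: pf')
    then show ?thesis by (simp only: mult.assoc distrib_right)
  qed
  \<comment> \<open>Modulo the Pfaffian, each coefficient times the form is the wedge product of two
    rows of its matrix. Whichever coefficient is nonzero supplies the basis vectors to take as
    \<open>e\<close> and \<open>f\<close>.\<close>
  have *: "h01 * ?H x y = ?H e0 x * ?H e1 y - ?H e0 y * ?H e1 x"
    "h02 * ?H x y = ?H e0 x * ?H e2 y - ?H e0 y * ?H e2 x"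
    "h03 * ?H x y = ?H e0 x * ?H e3 y - ?H e0 y * ?H e3 x"
    "h12 * ?H x y = ?H e1 x * ?H e2 y - ?H e1 y * ?H e2 x"
    "h13 * ?H x y = ?H e1 x * ?H e3 y - ?H e1 y * ?H e3 x"
    "h23 * ?H x y = ?H e2 x * ?H e3 y - ?H e2 y * ?H e3 x" for x y
    unfolding H unfolding form6_def pl_defs by (simp_all add: algebra_simps pf' pf'')
  consider "h01 \<noteq> 0" | "h02 \<noteq> 0" | "h03 \<noteq> 0" | "h12 \<noteq> 0" | "h13 \<noteq> 0" | "h23 \<noteq> 0"
    using nz by fast
  then show ?thesis
  proof cases
    case 1 then show ?thesis using *(1) basis(1) unfolding rank_two_form_def by metis
  next
    case 2 then show ?thesis using *(2) basis(2) unfolding rank_two_form_def by metis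
  next
    case 3 then show ?thesis using *(3) basis(3) unfolding rank_two_form_def by metis
  next
    case 4 then show ?thesis using *(4) basis(4) unfolding rank_two_form_def by metis
  next
    case 5 then show ?thesis using *(5) basis(5) unfolding rank_two_form_def by metis
  next
    case 6 then show ?thesis using *(6) basis(6) unfolding rank_two_form_def by metis
  qed
qed

section \<open>Symplectic spreads and their intersection with a radical\<close>

definition lagrangian :: "'a::field pt set \<Rightarrow> bool" where
  "lagrangian L \<longleftrightarrow> (\<exists>a b. omega a b = 0 \<and> indep a b \<and> L = span2 a b)"

definition spread :: "'a::field pt set set \<Rightarrow> bool" where
  "spread S \<longleftrightarrow> (\<forall>L\<in>S. lagrangian L) \<and> (\<forall>x. x \<noteq> 0 \<longrightarrow> (\<exists>!L. L \<in> S \<and> x \<in> L))"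

lemma lagrangian_zero: "lagrangian L \<Longrightarrow> 0 \<in> L"
  unfolding lagrangian_def using zero_in_span2 by blast

lemma lagrangian_diff: "lagrangian L \<Longrightarrow> x \<in> L \<Longrightarrow> y \<in> L \<Longrightarrow> x - y \<in> L"
  unfolding lagrangian_def using diff_in_span2 by blast

lemma card_lagrangian:
  fixes L :: "'a::{field,finite} pt set"
  shows "lagrangian L \<Longrightarrow> card L = CARD('a) ^ 2"
  unfolding lagrangian_def using card_span2 by blast

lemma card_lagrangian_inter_dvd:
  fixes L :: "'a::{field,finite} pt set"
  assumes "lagrangian L" "0 \<in> R" "\<And>x y. x \<in> R \<Longrightarrow> y \<in> R \<Longrightarrow> x - y \<in> R"
  shows "card (L \<inter> R) dvd CARD('a) ^ 2"
proof -
  have "card (L \<inter> R) dvd card L"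
    by (rule card_subgroup_dvd) (use assms lagrangian_zero lagrangian_diff in auto)
  then show ?thesis using card_lagrangian[OF assms(1)] by simp
qed

text \<open>Distinct members share only \<open>0\<close>, so away from \<open>0\<close> a spread is
  a genuine partition.\<close>

lemma card_spread_partition:
  fixes S :: "'a::{field,finite} pt set set"
  assumes "spread S" "0 \<notin> X"
  shows "card X = (\<Sum>L\<in>S. card (L \<inter> X))"
proof -
  have ex: "\<exists>L. L \<in> S \<and> x \<in> L" and uniq: "L \<in> S \<Longrightarrow> M \<in> S \<Longrightarrow> x \<in> L \<Longrightarrow> x \<in> M \<Longrightarrow> L = M"
    if "x \<noteq> 0" for x L M
    using assms(1) that unfolding spread_def by blast+
  have "x \<in> (\<Union>L\<in>S. L \<inter> X)" if "x \<in> X" for x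
    using ex[of x] that assms(2) by (cases "x = 0") blast+
  then have "X = (\<Union>L\<in>S. L \<inter> X)" by blast
  then have "card X = card (\<Union>L\<in>S. L \<inter> X)" by simp
  also have "\<dots> = (\<Sum>L\<in>S. card (L \<inter> X))"
  proof (rule card_UN_disjoint)
    show "\<forall>L\<in>S. \<forall>M\<in>S. L \<noteq> M \<longrightarrow> L \<inter> X \<inter> (M \<inter> X) = {}"
    proof (intro ballI impI equals0I)
      fix L M x assume "L \<in> S" "M \<in> S" "L \<noteq> M" "x \<in> L \<inter> X \<inter> (M \<inter> X)"
      with uniq[of x L M] assms(2) show False by (cases "x = 0") auto
    qed
  qed auto
  finally show ?thesis .
qed

lemma one_less_card_field: "1 < CARD('a::{field,finite})"
proof -
  have "card {0, 1 :: 'a} \<le> CARD('a)" by (rule card_mono) auto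
  then show ?thesis by simp
qed

lemma card_spread:
  fixes S :: "'a::{field,finite} pt set set"
  assumes "spread S"
  shows "card S = CARD('a) ^ 2 + 1"
proof -
  let ?q = "CARD('a)"
  have "card (UNIV - {0 :: 'a pt}) = (\<Sum>L\<in>S. card (L \<inter> (UNIV - {0})))"
    by (rule card_spread_partition[OF assms]) simp
  moreover have "card (UNIV - {0 :: 'a pt}) = ?q ^ 4 - 1"
    by (simp only: card_Diff_singleton UNIV_I CARD_pt)
  moreover have "card (L \<inter> (UNIV - {0})) = ?q ^ 2 - 1" if "L \<in> S" for L
  proof -
    have "lagrangian L" using assms that unfolding spread_def by blast
    then have "card (L - {0}) = ?q ^ 2 - 1" by (simp add: card_Diff_singleton lagrangian_zero card_lagrangian)
    then show ?thesis by (simp add: Diff_eq)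
  qed
  ultimately have "?q ^ 4 - 1 = card S * (?q ^ 2 - 1)" by simp
  moreover have "n * n - 1 = (n + 1) * (n - 1)" for n :: nat by (cases n) auto
  from this[of "?q ^ 2"] have "?q ^ 4 - 1 = (?q ^ 2 + 1) * (?q ^ 2 - 1)"
    by (simp only: power_add[symmetric]) simp
  moreover have "1 < ?q ^ 2" using one_less_card_field[where 'a='a] by (rule one_less_power) simp
  ultimately have "card S * (?q ^ 2 - 1) = (?q ^ 2 + 1) * (?q ^ 2 - 1)" "?q ^ 2 - 1 \<noteq> 0" by simp_all
  then show ?thesis using mult_right_cancel by blast
qed

text \<open>The radical has \<open>q\<^sup>2 - 1\<close> nonzero vectors, which the spread
  partitions. Exactly the members on which \<open>H\<close> vanishes get a share, and each share has
  size \<open>q ^ i - 1\<close> with \<open>i \<ge> 1\<close>. The first conclusion expresses that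
  the number of these members is 1 modulo \<open>q\<close>.\<close>

lemma card_vanishing_rank_two:
  fixes S :: "'a::{field,finite} pt set set"
  assumes "spread S" "prime CARD('a)" and H: "alt_form H" "rank_two_form H e f"
  shows "CARD('a) dvd card {L\<in>S. vanishes_on H L} + CARD('a) ^ 2 - 1" "card {L\<in>S. vanishes_on H L} \<le> CARD('a) + 1"
proof -
  let ?q = "CARD('a)" and ?R = "rad H" and ?N = "card {L\<in>S. vanishes_on H L}"
  have R0: "0 \<in> ?R"
  proof -
    have "H (comb 0 0 0 0) z = 0" for z by (simp add: alt_form_comb[OF H(1)])
    then show "0 \<in> ?R" unfolding rad_def comb_algebra(1) by blast
  qed
  have Rd: "x - y \<in> ?R" if "x \<in> ?R" "y \<in> ?R" for x y
  proof -
    have "x - y = comb x y 1 (- 1)" by (simp add: pt_eq_iff comb_simps)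
    then have "H (x - y) z = H x z - H y z" for z using alt_form_comb(1)[OF H(1), of x y 1 "- 1" z] by simp
    with that show "x - y \<in> ?R" unfolding rad_def by simp
  qed
  have lagrangian: "lagrangian L" if "L \<in> S" for L using assms(1) that unfolding spread_def by blast
  have vanishes_on: "vanishes_on H L \<longleftrightarrow> (\<exists>x\<in>L \<inter> ?R. x \<noteq> 0)" if "L \<in> S" for L
    using vanishes_on_span2_iff_meets_rad[OF H] lagrangian[OF that] unfolding lagrangian_def by blast
  have dvd: "card (L \<inter> ?R) dvd ?q ^ 2" if "L \<in> S" for L
    by (rule card_lagrangian_inter_dvd[OF lagrangian[OF that]]) (use R0 Rd in blast)+
  have zero: "0 \<in> L \<inter> ?R" if "L \<in> S" for L using lagrangian_zero[OF lagrangian[OF that]] R0 by blast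
  have minus: "card (L \<inter> (?R - {0})) + 1 = card (L \<inter> ?R)" if "L \<in> S" for L
  proof -
    have "L \<inter> (?R - {0}) = (L \<inter> ?R) - {0}" by blast
    then show ?thesis using card.remove[of "L \<inter> ?R" 0] zero[OF that] by simp
  qed
  have van_dvd: "?q dvd card (L \<inter> (?R - {0})) + 1" if "L \<in> S" "vanishes_on H L" for L
  proof -
    have "\<exists>x\<in>L \<inter> ?R. x \<noteq> 0" using vanishes_on[OF that(1)] that(2) by blast
    then obtain x where "x \<in> L \<inter> ?R" "x \<noteq> 0" by blast
    then have "card {0, x} \<le> card (L \<inter> ?R)" using zero[OF that(1)] by (intro card_mono) auto
    then have "card (L \<inter> ?R) \<noteq> 1" using \<open>x \<noteq> 0\<close> by simp
    moreover have "\<exists>i. card (L \<inter> ?R) = ?q ^ i"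
      using dvd[OF that(1)] divides_primepow_nat[OF assms(2)] by blast
    then obtain i where "card (L \<inter> ?R) = ?q ^ i" by blast
    ultimately show ?thesis unfolding minus[OF that(1)] by (cases i) auto
  qed
  have nvan: "card (L \<inter> (?R - {0})) = 0" if "L \<in> S" "\<not> vanishes_on H L" for L
  proof -
    have "L \<inter> (?R - {0}) = {}" using vanishes_on[OF that(1)] that(2) by blast
    then show ?thesis by simp
  qed
  have "card (?R - {0}) = ?q ^ 2 - 1" using R0 card_rad[OF H] by (simp add: card_Diff_singleton)
  moreover have "card (?R - {0}) = (\<Sum>L\<in>S. card (L \<inter> (?R - {0})))"
    by (rule card_spread_partition[OF assms(1)]) simp
  moreover have "\<dots> = (\<Sum>L\<in>{L\<in>S. vanishes_on H L}. card (L \<inter> (?R - {0})))"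
    by (rule sum.mono_neutral_right) (use nvan in auto)
  \<comment> \<open>Adding 1 for every member restores the zero vector, so that each summand is a
    positive power of \<open>q\<close>: divisible by \<open>q\<close> for the congruence, and at
    least \<open>q\<close> for the bound.\<close>
  ultimately have sum: "(\<Sum>L\<in>{L\<in>S. vanishes_on H L}. card (L \<inter> (?R - {0})) + 1) = ?N + (?q ^ 2 - 1)"
    by (simp only: sum.distrib) simp
  have q1: "1 < ?q ^ 2" using one_less_card_field[where 'a='a] by (rule one_less_power) simp
  have "?q dvd (\<Sum>L\<in>{L\<in>S. vanishes_on H L}. card (L \<inter> (?R - {0})) + 1)"
    by (rule dvd_sum) (use van_dvd in blast)
  then show "?q dvd ?N + ?q ^ 2 - 1" unfolding sum using q1 by simp
  have "(\<Sum>L\<in>{L\<in>S. vanishes_on H L}. ?q) \<le> (\<Sum>L\<in>{L\<in>S. vanishes_on H L}. card (L \<inter> (?R - {0})) + 1)"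
    by (rule sum_mono) (use van_dvd dvd_imp_le in simp)
  then have "?N * ?q \<le> ?N + (?q ^ 2 - 1)" unfolding sum by simp
  then have "?N * (?q - 1) \<le> (?q + 1) * (?q - 1)"
    by (simp add: algebra_simps power2_eq_square diff_mult_distrib2)
  moreover have "0 < ?q - 1" using one_less_card_field[where 'a='a] by simp
  ultimately show "?N \<le> ?q + 1" using mult_le_cancel2 by blast
qed

section \<open>Power sums of linear polynomials over a finite field\<close>

lemma degree_power_sum_le:
  fixes q :: "'i \<Rightarrow> 'b::comm_ring_1 poly"
  assumes "finite S" "\<And>i. i \<in> S \<Longrightarrow> degree (q i) \<le> 1"
  shows "degree (\<Sum>i\<in>S. q i ^ n) \<le> n"
proof (rule degree_sum_le[OF assms(1)])
  fix i assume "i \<in> S"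
  have "degree (q i ^ n) \<le> degree (q i) * n" by (rule degree_power_le)
  also have "\<dots> \<le> 1 * n" using assms(2)[OF \<open>i \<in> S\<close>] by (rule mult_le_mono1)
  finally show "degree (q i ^ n) \<le> n" by simp
qed

lemma poly_eq_0_of_roots:
  fixes P :: "'b::idom poly"
  assumes "degree P < card R" "finite R" "\<And>x. x \<in> R \<Longrightarrow> poly P x = 0"
  shows "P = 0"
proof (rule ccontr)
  assume "P \<noteq> 0"
  have "card R \<le> card {x. poly P x = 0}"
    by (rule card_mono) (use poly_roots_finite[OF \<open>P \<noteq> 0\<close>] assms(3) in auto)
  also have "\<dots> \<le> degree P" by (rule card_poly_roots_bound[OF \<open>P \<noteq> 0\<close>])
  finally show False using assms(1) by simp
qed

text \<open>As a polynomial in \<open>a\<close> over the polynomials in \<open>b\<close>, the sum has degree less than \<open>CARD('a)\<close>, but the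
  \<open>CARD('a)\<close> different roots \<open>r b + r\<^sup>2\<close>.\<close>

lemma power_sum_vanishes:
  fixes u v w :: "'i \<Rightarrow> 'a::{field,finite}"
  assumes "finite S"
    and zero: "\<And>r b. (\<Sum>i\<in>S. (u i + b * v i + (r * b + r ^ 2) * w i) ^ (CARD('a) - 1)) = 0"
  shows "(\<Sum>i\<in>S. (u i + b * v i + a * w i) ^ (CARD('a) - 1)) = 0"
proof -
  let ?n = "CARD('a) - 1"
  have q: "?n < CARD('a)" using one_less_card_field[where 'a='a] by simp
  \<comment> \<open>The outer variable is \<open>a\<close> and the inner one \<open>b\<close>; each
    base is \<open>(u i + b * v i) + a * w i\<close>.\<close>
  define P :: "'a poly poly" where "P = (\<Sum>i\<in>S. [:[:u i, v i:], [:w i:]:] ^ ?n)"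
  \<comment> \<open>Substituting \<open>a = r * b + r ^ 2\<close> leaves a polynomial in
    \<open>b\<close> of degree below \<open>CARD('a)\<close> that vanishes on the whole
    field.\<close>
  have root: "poly P [:r ^ 2, r:] = 0" for r
  proof (rule poly_eq_0_of_roots[where R = UNIV])
    have eq: "poly P [:r ^ 2, r:] = (\<Sum>i\<in>S. [:u i + r ^ 2 * w i, v i + r * w i:] ^ ?n)"
      unfolding P_def by (simp add: poly_sum poly_power mult.commute)
    show "degree (poly P [:r ^ 2, r:]) < CARD('a)"
      unfolding eq by (rule le_less_trans[OF degree_power_sum_le[OF assms(1)] q]) simp
    show "poly (poly P [:r ^ 2, r:]) b = 0" for b
      using zero[of b r] unfolding eq by (simp add: poly_sum poly_power algebra_simps)
  qed simp
  have inj: "inj (\<lambda>r::'a. [:r ^ 2, r:])" by (rule injI) simp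
  have "P = 0"
  proof (rule poly_eq_0_of_roots[where R = "range (\<lambda>r. [:r ^ 2, r:])"])
    have "degree P \<le> ?n" unfolding P_def by (rule degree_power_sum_le[OF assms(1)]) simp
    then show "degree P < card (range (\<lambda>r::'a. [:r ^ 2, r:]))"
      unfolding card_image[OF inj] using q by (rule le_less_trans)
  qed (use root in auto)
  then have "poly (poly P [:a:]) b = 0" by simp
  then show ?thesis unfolding P_def by (simp add: poly_sum poly_power algebra_simps)
qed

text \<open>Adding multiples of \<^term>\<open>omega\<close> does not change a form on Lagrangian planes, so the coefficient of
  \<^term>\<open>pl13\<close> is normalised to \<open>0\<close>.\<close>

definition form5 :: "'a::field \<times> 'a \<times> 'a \<times> 'a \<times> 'a \<Rightarrow> 'a pt \<Rightarrow> 'a pt \<Rightarrow> 'a" where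
  "form5 = (\<lambda>(h01, h02, h03, h12, h23). form6 h01 h02 h03 h12 0 h23)"

lemma alt_form_form5: "alt_form (form5 h)"
  by (cases h) (simp only: form5_def prod.case alt_form_form6)

text \<open>\<open>wedge a b c d\<close> is the determinant with columns \<open>a, b, c, d\<close>.\<close>

definition wedge :: "'a::field pt \<Rightarrow> 'a pt \<Rightarrow> 'a pt \<Rightarrow> 'a pt \<Rightarrow> 'a" where
  "wedge a b = form6 (pl23 a b) (- pl13 a b) (pl12 a b) (pl03 a b) (- pl02 a b) (pl01 a b)"

section \<open>Planes as radicals of wedge forms, and polar forms\<close>

text \<open>If all minors vanish, then \<open>b_i * a - a_i * b = 0\<close> for each coordinate
  \<open>i\<close>; independence turns this into \<open>a = 0\<close>. The tuple lists the
  coefficients of \<open>wedge a b\<close>.\<close>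

lemma indep_pl_nonzero:
  assumes "indep a b"
  shows "(pl23 a b, - pl13 a b, pl12 a b, pl03 a b, - pl02 a b, pl01 a b) \<noteq> (0, 0, 0, 0, 0, 0)"
proof
  assume "(pl23 a b, - pl13 a b, pl12 a b, pl03 a b, - pl02 a b, pl01 a b) = (0, 0, 0, 0, 0, 0)"
  then have z: "pl01 a b = 0" "pl02 a b = 0" "pl03 a b = 0" "pl12 a b = 0" "pl13 a b = 0" "pl23 a b = 0"
    by simp_all
  have "comb a b (fst b $ 1) (- fst a $ 1) = 0" "comb a b (fst b $ 2) (- fst a $ 2) = 0"
    "comb a b (snd b $ 1) (- snd a $ 1) = 0" "comb a b (snd b $ 2) (- snd a $ 2) = 0"
    using z by (auto simp: pt_eq_iff comb_simps pl_defs algebra_simps)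
  then have "- fst a $ 1 = 0" "- fst a $ 2 = 0" "- snd a $ 1 = 0" "- snd a $ 2 = 0"
    using assms unfolding indep_def by blast+
  then have "a = 0" by (simp add: pt_eq_iff)
  then have "comb a b 1 0 = 0" by (simp only: comb_algebra)
  then have "(1::'a) = 0" using assms unfolding indep_def by blast
  then show False by simp
qed

text \<open>The Pfaffian of \<open>wedge a b\<close> is the Pluecker relation between the minors of
  \<open>a\<close> and \<open>b\<close>.\<close>

lemma rank_two_wedge: "indep a b \<Longrightarrow> \<exists>e f. rank_two_form (wedge a b) e f"
  unfolding wedge_def by (rule rank_two_form6[OF _ indep_pl_nonzero]) (simp add: pl_defs algebra_simps)

text \<open>A determinant with a repeated column is zero, which gives one inclusion; both sides have
  the same cardinality.\<close>

lemma rad_wedge: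
  fixes a b :: "'a::{field,finite} pt"
  assumes "indep a b"
  shows "rad (wedge a b) = span2 a b"
proof -
  obtain e f where ef: "rank_two_form (wedge a b) e f" using rank_two_wedge[OF assms] by blast
  have alt: "alt_form (wedge a b)" unfolding wedge_def by (rule alt_form_form6)
  have "wedge a b a z = 0" "wedge a b b z = 0" for z
    by (simp_all add: wedge_def form6_def pl_defs algebra_simps)
  then have "wedge a b (comb a b c d) z = 0" for c d z unfolding alt_form_comb(1)[OF alt] by simp
  then have "span2 a b \<subseteq> rad (wedge a b)" unfolding span2_def rad_def by blast
  then show ?thesis
    using card_subset_eq[of "rad (wedge a b)" "span2 a b"] card_rad[OF alt ef] card_span2[OF assms] by simp
qed

text \<open>The coefficients of \<open>wedge a b\<close> normalised for \<open>form5\<close>: for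
  \<open>omega a b = 0\<close>, adding \<open>pl02 a b\<close> times \<open>omega\<close> removes
  the coefficient of \<open>pl13\<close> and doubles that of \<open>pl02\<close>. Geometrically this
  is the polar hyperplane of a point of the quadric.\<close>

definition polar :: "'a::field pt \<Rightarrow> 'a pt \<Rightarrow> 'a \<times> 'a \<times> 'a \<times> 'a \<times> 'a" where
  "polar a b = (pl23 a b, 2 * pl02 a b, pl12 a b, pl03 a b, pl01 a b)"

lemma form5_polar:
  assumes "omega a b = 0" "omega c d = 0"
  shows "form5 (polar a b) c d = wedge a b c d"
proof -
  have "pl13 a b = - pl02 a b" "pl13 c d = - pl02 c d"
    using assms by (simp_all add: omega_def eq_neg_iff_add_eq_0 add.commute)
  then show ?thesis by (simp add: form5_def polar_def wedge_def form6_def)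
qed

lemma form5_add: "form5 (h + k) a b = form5 h a b + form5 k a b"
  by (cases h, cases k) (simp add: form5_def form6_def algebra_simps)

definition scale5 :: "'a::field \<Rightarrow> 'a \<times> 'a \<times> 'a \<times> 'a \<times> 'a \<Rightarrow> 'a \<times> 'a \<times> 'a \<times> 'a \<times> 'a" where
  "scale5 c = (\<lambda>(h01, h02, h03, h12, h23). (c * h01, c * h02, c * h03, c * h12, c * h23))"

lemma form5_scale5: "form5 (scale5 c h) a b = c * form5 h a b"
  by (cases h) (simp add: form5_def form6_def scale5_def algebra_simps)

section \<open>Hyperplane sections of a spread\<close>

lemma sum_two_values:
  fixes f :: "'i \<Rightarrow> int"
  assumes "finite S" "T \<subseteq> S" "\<And>x. x \<in> T \<Longrightarrow> f x = a" "\<And>x. x \<in> S - T \<Longrightarrow> f x = b"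
  shows "sum f S = int (card T) * a + (int (card S) - int (card T)) * b"
proof -
  have "finite T" using assms(1,2) finite_subset by blast
  have "sum f S = sum f (S - T) + sum f T" by (rule sum.subset_diff[OF assms(2,1)])
  also have "sum f T = (\<Sum>x\<in>T. a)" by (rule sum.cong) (use assms in auto)
  also have "sum f (S - T) = (\<Sum>x\<in>S - T. b)" by (rule sum.cong) (use assms in auto)
  finally have "sum f S = int (card (S - T)) * b + int (card T) * a" by simp
  moreover have "int (card (S - T)) = int (card S) - int (card T)"
    using card_Diff_subset[OF \<open>finite T\<close> assms(2)] card_mono[OF assms(1,2)] by simp
  ultimately show ?thesis by simp
qed

lemma sum_cube:
  fixes x :: "'i \<Rightarrow> int"
  shows "(\<Sum>i\<in>S. x i) ^ 3 = (\<Sum>i\<in>S. \<Sum>j\<in>S. \<Sum>k\<in>S. x i * x j * x k)"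
proof -
  have "(\<Sum>i\<in>S. x i) ^ 3 = (\<Sum>i\<in>S. \<Sum>j\<in>S. x i * x j) * (\<Sum>k\<in>S. x k)"
    by (simp only: power3_eq_cube sum_product)
  also have "\<dots> = (\<Sum>i\<in>S. \<Sum>j\<in>S. x i * x j * (\<Sum>k\<in>S. x k))"
    by (simp only: sum_distrib_right)
  also have "\<dots> = (\<Sum>i\<in>S. \<Sum>j\<in>S. \<Sum>k\<in>S. x i * x j * x k)"
    by (simp only: sum_distrib_left)
  finally show ?thesis .
qed

text \<open>A basis chosen for every member turns evaluation of a form on that member into a scalar.
  Another basis multiplies the scalar by a nonzero determinant, so its vanishing is
  intrinsic.\<close>

locale based_spread =
  fixes S :: "'p::prime_card mod_ring pt set set" and A B :: "'p mod_ring pt set \<Rightarrow> 'p mod_ring pt" and p :: nat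
  assumes p_def: "p = CARD('p)" and spread: "spread S"
    and base: "\<And>L. L \<in> S \<Longrightarrow> omega (A L) (B L) = 0" "\<And>L. L \<in> S \<Longrightarrow> indep (A L) (B L)"
      "\<And>L. L \<in> S \<Longrightarrow> L = span2 (A L) (B L)"
begin

abbreviation ev :: "'p mod_ring \<times> 'p mod_ring \<times> 'p mod_ring \<times> 'p mod_ring \<times> 'p mod_ring \<Rightarrow>
    'p mod_ring pt set \<Rightarrow> 'p mod_ring" where
  "ev h L \<equiv> form5 h (A L) (B L)"

definition N :: "'p mod_ring \<times> 'p mod_ring \<times> 'p mod_ring \<times> 'p mod_ring \<times> 'p mod_ring \<Rightarrow> nat" where
  "N h = card {L\<in>S. ev h L = 0}"

lemma prime_p: "prime p" unfolding p_def by (rule prime_card)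

lemma card_S: "card S = p ^ 2 + 1"
  using card_spread[OF spread] by (simp add: p_def)

lemma card_nonvanishing: "card {L\<in>S. ev h L \<noteq> 0} = p ^ 2 + 1 - N h"
proof -
  have "card S = card {L\<in>S. ev h L = 0} + card {L\<in>S. ev h L \<noteq> 0}"
    by (subst card_Un_disjoint[symmetric]) (auto intro: arg_cong[where f = card])
  then show ?thesis unfolding N_def card_S by simp
qed

lemma N_le: "N h \<le> p ^ 2 + 1"
  unfolding N_def card_S[symmetric] by (rule card_mono) auto

lemma ev_eq_shift:
  assumes "L \<in> S"
  shows "ev (h01, h02, h03, h12, h23) L = form6 h01 (h02 - l) h03 h12 (- l) h23 (A L) (B L)"
proof -
  have "pl13 (A L) (B L) = - pl02 (A L) (B L)"
    using base(1)[OF assms] by (simp add: omega_def eq_neg_iff_add_eq_0 add.commute)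
  then show ?thesis by (simp add: form5_def form6_def algebra_simps)
qed

text \<open>By the first hypothesis, the Pfaffian of \<open>h - l \<omega>\<close> is zero.\<close>

lemma N_degenerate:
  assumes "l ^ 2 - h02 * l = h01 * h23 + h03 * h12" "(h01, h02, h03, h12, h23) \<noteq> 0"
  shows "p dvd N (h01, h02, h03, h12, h23) + p ^ 2 - 1" "N (h01, h02, h03, h12, h23) \<le> p + 1"
proof -
  let ?H = "form6 h01 (h02 - l) h03 h12 (- l) h23"
  have pf: "h01 * h23 - (h02 - l) * (- l) + h03 * h12 = 0"
    using assms(1) by (simp add: algebra_simps power2_eq_square)
  have nz: "(h01, h02 - l, h03, h12, - l, h23) \<noteq> (0, 0, 0, 0, 0, 0)"
    using assms(2) by (auto simp: zero_prod_def)
  obtain e f where ef: "rank_two_form ?H e f" using rank_two_form6[OF pf nz] by blast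
  have "vanishes_on ?H L \<longleftrightarrow> ev (h01, h02, h03, h12, h23) L = 0" if "L \<in> S" for L
    using vanishes_on_span2_iff[OF alt_form_form6, of h01 "h02 - l" h03 h12 "- l" h23 "A L" "B L"]
    unfolding base(3)[OF that, symmetric] ev_eq_shift[OF that, of _ _ _ _ _ l] .
  then have "{L\<in>S. vanishes_on ?H L} = {L\<in>S. ev (h01, h02, h03, h12, h23) L = 0}" by blast
  then have "N (h01, h02, h03, h12, h23) = card {L\<in>S. vanishes_on ?H L}" unfolding N_def by simp
  then show "p dvd N (h01, h02, h03, h12, h23) + p ^ 2 - 1" "N (h01, h02, h03, h12, h23) \<le> p + 1"
    using card_vanishing_rank_two[OF spread _ alt_form_form6 ef] prime_p by (simp_all add: p_def)
qed

definition power_sum where "power_sum h = (\<Sum>L\<in>S. ev h L ^ (p - 1))"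

lemma power_p_minus_1: "x ^ (p - 1) = (if x = 0 then 0 else 1)" for x :: "'p mod_ring"
proof (cases "x = 0")
  case True
  have "p - 1 \<noteq> 0" using prime_gt_1_nat[OF prime_p] by simp
  with True show ?thesis by simp
next
  case False
  have "x * x ^ (p - 1) = x ^ p"
    using prime_gt_0_nat[OF prime_p] by (simp add: power_eq_if)
  also have "\<dots> = x" using finite_field_power_card_eq_same[of x] by (simp add: p_def)
  finally show ?thesis using False by simp
qed

text \<open>By Fermat's little theorem the exponent \<open>p - 1\<close> gives the indicator of
  being nonzero, so the power sum counts, modulo \<open>p\<close>, the members on which
  \<open>h\<close> does not vanish.\<close>

lemma power_sum_eq: "power_sum h = of_nat (p ^ 2 + 1 - N h)"
proof -
  have "power_sum h = (\<Sum>L\<in>S. if ev h L \<noteq> 0 then 1 else 0)"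
    unfolding power_sum_def by (intro sum.cong refl) (simp only: power_p_minus_1, simp)
  also have "\<dots> = of_nat (card {L\<in>S. ev h L \<noteq> 0})"
    by (simp add: sum.If_cases Int_def)
  finally show ?thesis unfolding card_nonvanishing .
qed

lemma power_sum_0: "power_sum 0 = 0"
proof -
  have "ev 0 L = 0" for L by (simp add: zero_prod_def form5_def form6_def)
  then show ?thesis unfolding power_sum_def power_p_minus_1 by simp
qed

lemma power_sum_degenerate:
  assumes "l ^ 2 - h02 * l = h01 * h23 + h03 * h12"
  shows "power_sum (h01, h02, h03, h12, h23) = 0"
proof (cases "(h01, h02, h03, h12, h23) = 0")
  case True then show ?thesis by (simp only: power_sum_0)
next
  case False
  let ?N = "N (h01, h02, h03, h12, h23)"
  have "p dvd ?N + p ^ 2 - 1" by (rule N_degenerate(1)[OF assms False])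
  \<comment> \<open>The two natural-number differences add up to \<open>2 * p ^ 2\<close>, so
    divisibility by \<open>p\<close> passes from one to the other.\<close>
  moreover have "n + m - 1 + (m + 1 - n) = 2 * m" if "n \<le> m + 1" "0 < m" for n m :: nat
    using that by arith
  from this[OF N_le] have "(?N + p ^ 2 - 1) + (p ^ 2 + 1 - ?N) = 2 * p ^ 2"
    using prime_gt_0_nat[OF prime_p] by simp
  moreover have "2 * p ^ 2 = p * (2 * p)" by (simp add: power2_eq_square)
  ultimately have "p dvd p ^ 2 + 1 - ?N" by (metis dvd_add_right_iff dvd_triv_left)
  then obtain k where "p ^ 2 + 1 - ?N = p * k" by (elim dvdE)
  then show ?thesis unfolding power_sum_eq by (simp add: p_def)
qed

text \<open>For \<open>h01 * h23 + h03 * h12 = r * h02 + r\<^sup>2\<close>, the scalar \<open>l = - r\<close> witnesses degeneracy; this is the shape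
  of the roots in \<open>power_sum_vanishes\<close>.\<close>

lemma power_sum_zero: "power_sum h = 0"
proof -
  obtain h01 h02 h03 h12 h23 where h: "h = (h01, h02, h03, h12, h23)" by (cases h) auto
  let ?p01 = "\<lambda>L. pl01 (A L) (B L)" and ?p02 = "\<lambda>L. pl02 (A L) (B L)" and ?p03 = "\<lambda>L. pl03 (A L) (B L)"
    and ?p12 = "\<lambda>L. pl12 (A L) (B L)" and ?p23 = "\<lambda>L. pl23 (A L) (B L)"
  \<comment> \<open>The parameter \<open>a\<close> stands for \<open>h01 * h23 + h03 * h12\<close>
    and \<open>b\<close> for \<open>h02\<close>. It is varied through \<open>h01\<close> if
    \<open>h23\<close> is nonzero, otherwise through \<open>h12\<close> if \<open>h03\<close> is
    nonzero; if both vanish, \<open>l = 0\<close> already witnesses degeneracy.\<close>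
  consider (1) "h23 \<noteq> 0" | (2) "h23 = 0" "h03 \<noteq> 0" | (3) "h23 = 0" "h03 = 0" by blast
  then show ?thesis
  proof cases
    case 1
    \<comment> \<open>The part of the evaluation that depends on neither \<open>a\<close> nor
      \<open>b\<close> once \<open>h01\<close> is written as
      \<open>(a - h03 * h12) / h23\<close>.\<close>
    let ?u = "\<lambda>L. - (h03 * h12 / h23) * ?p01 L + h03 * ?p03 L + h12 * ?p12 L + h23 * ?p23 L"
    have ev: "ev ((a - h03 * h12) / h23, b, h03, h12, h23) L = ?u L + b * ?p02 L + a * (?p01 L / h23)"
      for a b L by (simp add: form5_def form6_def diff_divide_distrib algebra_simps)
    have "(\<Sum>L\<in>S. (?u L + h02 * ?p02 L + (h01 * h23 + h03 * h12) * (?p01 L / h23)) ^ (CARD('p mod_ring) - 1)) = 0"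
    proof (rule power_sum_vanishes)
      fix r b :: "'p mod_ring"
      have "power_sum ((r * b + r ^ 2 - h03 * h12) / h23, b, h03, h12, h23) = 0"
        by (rule power_sum_degenerate[where l = "- r"]) (use 1 in simp)
      then show "(\<Sum>L\<in>S. (?u L + b * ?p02 L + (r * b + r ^ 2) * (?p01 L / h23)) ^ (CARD('p mod_ring) - 1)) = 0"
        unfolding power_sum_def ev by (simp add: p_def)
    qed simp
    then have "power_sum ((h01 * h23 + h03 * h12 - h03 * h12) / h23, h02, h03, h12, h23) = 0"
      unfolding power_sum_def ev by (simp add: p_def)
    then show ?thesis using 1 unfolding h by simp
  next
    case 2
    let ?u = "\<lambda>L. h01 * ?p01 L + h03 * ?p03 L"
    have ev: "ev (h01, b, h03, a / h03, 0) L = ?u L + b * ?p02 L + a * (?p12 L / h03)" for a b L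
      by (simp add: form5_def form6_def algebra_simps)
    have "(\<Sum>L\<in>S. (?u L + h02 * ?p02 L + (h12 * h03) * (?p12 L / h03)) ^ (CARD('p mod_ring) - 1)) = 0"
    proof (rule power_sum_vanishes)
      fix r b :: "'p mod_ring"
      have "power_sum (h01, b, h03, (r * b + r ^ 2) / h03, 0) = 0"
        by (rule power_sum_degenerate[where l = "- r"]) (use 2 in simp)
      then show "(\<Sum>L\<in>S. (?u L + b * ?p02 L + (r * b + r ^ 2) * (?p12 L / h03)) ^ (CARD('p mod_ring) - 1)) = 0"
        unfolding power_sum_def ev by (simp add: p_def)
    qed simp
    then have "power_sum (h01, h02, h03, h12 * h03 / h03, 0) = 0"
      unfolding power_sum_def ev by (simp add: p_def)
    then show ?thesis using 2 unfolding h by simp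
  next
    case 3
    then show ?thesis unfolding h by (intro power_sum_degenerate[where l = 0]) simp
  qed
qed

lemma N_cong: "p dvd p ^ 2 + 1 - N h"
proof -
  have "of_nat (p ^ 2 + 1 - N h) = (0 :: 'p mod_ring)" using power_sum_zero[of h] unfolding power_sum_eq .
  from of_nat_0_mod_ring_dvd[OF this] show ?thesis unfolding p_def[symmetric] .
qed

text \<open>The congruence combined with \<open>N h \<le> p\<^sup>2 + 1\<close>. In particular
  \<open>N h\<close> is never 0, which is what the comparison of two spreads uses.\<close>

lemma N_cases: "\<exists>m. N h = 1 + p * m \<and> m \<le> p"
proof -
  obtain k where k: "p ^ 2 + 1 - N h = p * k" using N_cong[of h] by (elim dvdE)
  have p1: "1 < p" by (rule prime_gt_1_nat[OF prime_p])
  have eq: "p * p + 1 = p * k + N h" using k N_le[of h] by (simp add: power2_eq_square)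
  have "k \<le> p"
  proof (rule ccontr)
    assume "\<not> k \<le> p"
    then have "p * (p + 1) \<le> p * k" by (intro mult_le_mono2) simp
    with eq p1 show False by simp
  qed
  then obtain j where j: "p = k + j" using le_Suc_ex by blast
  have "p * p = p * k + p * j" by (simp only: distrib_left[symmetric] j[symmetric])
  then show ?thesis using eq j by (intro exI[of _ j]) simp
qed

section \<open>Moments of the number of zeros, computed with polar forms\<close>

definition polar_of where "polar_of L = polar (A L) (B L)"

text \<open>The value is the determinant of the two bases together. Were it zero, \<open>M\<close>
  would meet the radical of the wedge form of \<open>L\<close>, which is \<open>L\<close> itself, in
  a nonzero vector.\<close>

lemma ev_polar_nonzero:
  assumes "L \<in> S" "M \<in> S" "L \<noteq> M"
  shows "ev (polar_of L) M \<noteq> 0"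
proof
  assume 0: "ev (polar_of L) M = 0"
  obtain e f where ef: "rank_two_form (wedge (A L) (B L)) e f"
    using rank_two_wedge[OF base(2)[OF assms(1)]] by blast
  have alt: "alt_form (wedge (A L) (B L))" unfolding wedge_def by (rule alt_form_form6)
  have "wedge (A L) (B L) (A M) (B M) = 0"
    using 0 unfolding polar_of_def form5_polar[OF base(1)[OF assms(1)] base(1)[OF assms(2)]] .
  then have "vanishes_on (wedge (A L) (B L)) (span2 (A M) (B M))" unfolding vanishes_on_span2_iff[OF alt] .
  then obtain x where x: "x \<in> span2 (A M) (B M)" "x \<in> rad (wedge (A L) (B L))" "x \<noteq> 0"
    unfolding vanishes_on_span2_iff_meets_rad[OF alt ef base(2)[OF assms(2)]] by blast
  then have "x \<in> M" "x \<in> L"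
    unfolding rad_wedge[OF base(2)[OF assms(1)]] base(3)[OF assms(1), symmetric] base(3)[OF assms(2), symmetric]
    by blast+
  then show False using spread assms x(3) unfolding spread_def by blast
qed

lemma ev_polar_self:
  assumes "L \<in> S"
  shows "ev (polar_of L) L = 0"
  unfolding polar_of_def form5_polar[OF base(1)[OF assms] base(1)[OF assms]]
  by (simp add: wedge_def form6_def pl_defs algebra_simps)

text \<open>Symmetry of the bilinear form associated with the quadric.\<close>

lemma ev_polar_commute: "ev (polar_of L) M = ev (polar_of M) L"
  unfolding polar_of_def by (simp add: form5_def polar_def form6_def algebra_simps)

lemma ev_add: "ev (h + k) L = ev h L + ev k L" by (rule form5_add)

lemma ev_scale: "ev (scale5 c h) L = c * ev h L" by (rule form5_scale5)

lemma card_params: "CARD('p mod_ring \<times> 'p mod_ring \<times> 'p mod_ring \<times> 'p mod_ring \<times> 'p mod_ring) = p ^ 5"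
  by (simp add: p_def power_numeral_reduce)

lemma p_pos: "0 < p" using prime_gt_0_nat[OF prime_p] .

lemma card_ker1:
  assumes "L \<in> S"
  shows "card {h. ev h L = 0} = p ^ 4"
proof -
  have "\<not> S \<subseteq> {L}"
  proof
    assume "S \<subseteq> {L}"
    then have "card S \<le> 1" using card_mono[of "{L}" S] by simp
    then show False using p_pos by (simp add: card_S)
  qed
  then obtain M where M: "M \<in> S" "M \<noteq> L" by blast
  have nz: "ev (polar_of M) L \<noteq> 0" using ev_polar_nonzero[OF M(1) assms M(2)] .
  have "CARD('p mod_ring \<times> 'p mod_ring \<times> 'p mod_ring \<times> 'p mod_ring \<times> 'p mod_ring) =
      card {h. ev h L = 0} * CARD('p mod_ring)"
  proof (rule card_kernel)
    show "\<exists>h. ev h L = y" for y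
      using nz by (intro exI[of _ "scale5 (y / ev (polar_of M) L) (polar_of M)"]) (simp add: ev_scale)
  qed (rule ev_add)
  then have "p * p ^ 4 = p * card {h. ev h L = 0}"
    unfolding card_params by (simp add: p_def power_numeral_reduce mult_ac)
  then show ?thesis using p_pos by simp
qed

text \<open>The polar form of each of the two members vanishes at that member but not at the other,
  so suitable multiples attain every pair of values.\<close>

lemma card_ker2:
  assumes "L \<in> S" "M \<in> S" "L \<noteq> M"
  shows "card {h. ev h L = 0 \<and> ev h M = 0} = p ^ 3"
proof -
  let ?c = "ev (polar_of L) M"
  have nz: "?c \<noteq> 0" using ev_polar_nonzero[OF assms] .
  have "CARD('p mod_ring \<times> 'p mod_ring \<times> 'p mod_ring \<times> 'p mod_ring \<times> 'p mod_ring) =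
      card {h. (ev h L, ev h M) = 0} * CARD('p mod_ring \<times> 'p mod_ring)"
  proof (rule card_kernel)
    show "\<exists>h. (ev h L, ev h M) = y" for y
      using nz assms
      by (intro exI[of _ "scale5 (fst y / ?c) (polar_of M) + scale5 (snd y / ?c) (polar_of L)"])
        (simp add: ev_scale ev_add ev_polar_self ev_polar_commute[of M L] prod_eq_iff)
  qed (simp only: ev_add add_Pair)
  then have "p * p * p ^ 3 = p * p * card {h. ev h L = 0 \<and> ev h M = 0}"
    unfolding card_params by (simp add: p_def power_numeral_reduce mult_ac zero_prod_def)
  then show ?thesis using p_pos by simp
qed

text \<open>The values of the three polar forms at the three members make a symmetric matrix with
  zero diagonal and off-diagonal entries \<open>a\<close>, \<open>b\<close>, \<open>c\<close>. Its
  determinant is \<open>2 * a * b * c\<close>, and this is where the oddness of \<open>p\<close>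
  enters.\<close>

lemma card_ker3:
  assumes "odd p" and S: "L \<in> S" "M \<in> S" "K \<in> S" and "L \<noteq> M" "L \<noteq> K" "M \<noteq> K"
  shows "card {h. ev h L = 0 \<and> ev h M = 0 \<and> ev h K = 0} = p ^ 2"
proof -
  let ?a = "ev (polar_of L) M" and ?b = "ev (polar_of L) K" and ?c = "ev (polar_of M) K"
  have nz: "?a \<noteq> 0" "?b \<noteq> 0" "?c \<noteq> 0" using ev_polar_nonzero assms by auto
  have two: "(2 :: 'p mod_ring) \<noteq> 0"
  proof
    assume "(2 :: 'p mod_ring) = 0"
    then have "of_nat 2 = (0 :: 'p mod_ring)" by simp
    from of_nat_0_mod_ring_dvd[OF this] have "p dvd 2" unfolding p_def .
    then have "p \<le> 2" by (rule dvd_imp_le) simp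
    then show False using prime_gt_1_nat[OF prime_p] \<open>odd p\<close> by (cases "p = 2") auto
  qed
  have "CARD('p mod_ring \<times> 'p mod_ring \<times> 'p mod_ring \<times> 'p mod_ring \<times> 'p mod_ring) =
      card {h. (ev h L, ev h M, ev h K) = 0} * CARD('p mod_ring \<times> 'p mod_ring \<times> 'p mod_ring)"
  proof (rule card_kernel)
    fix y :: "'p mod_ring \<times> 'p mod_ring \<times> 'p mod_ring"
    obtain r s t where y: "y = (r, s, t)" by (cases y) auto
    \<comment> \<open>The coefficients solve the 3 by 3 linear system for the prescribed values
      \<open>r\<close>, \<open>s\<close>, \<open>t\<close>.\<close>
    let ?h = "scale5 ((?b * s + ?a * t - ?c * r) / (2 * ?a * ?b)) (polar_of L)
      + (scale5 ((?c * r + ?a * t - ?b * s) / (2 * ?a * ?c)) (polar_of M)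
      + scale5 ((?c * r + ?b * s - ?a * t) / (2 * ?b * ?c)) (polar_of K))"
    have "ev ?h L = (?c * r + ?a * t - ?b * s) / (2 * ?a * ?c) * ?a + (?c * r + ?b * s - ?a * t) / (2 * ?b * ?c) * ?b"
      "ev ?h M = (?b * s + ?a * t - ?c * r) / (2 * ?a * ?b) * ?a + (?c * r + ?b * s - ?a * t) / (2 * ?b * ?c) * ?c"
      "ev ?h K = (?b * s + ?a * t - ?c * r) / (2 * ?a * ?b) * ?b + (?c * r + ?a * t - ?b * s) / (2 * ?a * ?c) * ?c"
      using S by (simp_all only: ev_scale ev_add ev_polar_self ev_polar_commute[of M L] ev_polar_commute[of K L] ev_polar_commute[of K M])
        simp_all
    then have "ev ?h L = r" "ev ?h M = s" "ev ?h K = t"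
      using nz two by (simp_all add: divide_simps)
    then show "\<exists>h. (ev h L, ev h M, ev h K) = y" unfolding y by blast
  qed (simp only: ev_add add_Pair)
  then have "p * p * p * p ^ 2 = p * p * p * card {h. ev h L = 0 \<and> ev h M = 0 \<and> ev h K = 0}"
    unfolding card_params by (simp add: p_def power_numeral_reduce mult_ac zero_prod_def)
  then show ?thesis using p_pos by simp
qed

definition joint_zeros where "joint_zeros L M K = int (card {h. ev h L = 0 \<and> ev h M = 0 \<and> ev h K = 0})"

lemma N_eq_sum: "int (N h) = (\<Sum>L\<in>S. of_bool (ev h L = 0))"
  unfolding N_def by (simp add: of_bool_def sum.If_cases Int_def)

lemma sum_joint_zeros_eq: "(\<Sum>h\<in>UNIV. of_bool (ev h L = 0) * of_bool (ev h M = 0) * of_bool (ev h K = 0)) = joint_zeros L M K"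
  unfolding joint_zeros_def by (simp add: of_bool_conj[symmetric] conj_assoc)

text \<open>For \<open>L = M\<close>, the term \<open>K = L\<close> gives \<open>p ^ 4\<close> and
  the other \<open>p\<^sup>2\<close> members give \<open>p ^ 3\<close> each. Otherwise
  \<open>K\<close> coincides with \<open>L\<close> or \<open>M\<close> twice, giving
  \<open>p ^ 3\<close>, and the remaining \<open>p\<^sup>2 - 1\<close> members give
  \<open>p\<^sup>2\<close> each.\<close>

lemma sum_joint_zeros:
  assumes "odd p" "L \<in> S" "M \<in> S"
  shows "(\<Sum>K\<in>S. joint_zeros L M K) = (if L = M then int p ^ 4 + int p ^ 5 else 2 * int p ^ 3 + (int p ^ 2 - 1) * int p ^ 2)"
proof (cases "L = M")
  case True
  have "(\<Sum>K\<in>S. joint_zeros L M K) = int (card {L}) * int p ^ 4 + (int (card S) - int (card {L})) * int p ^ 3"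
    by (rule sum_two_values) (use True assms card_ker1[of L] card_ker2[of L] in \<open>auto simp: joint_zeros_def\<close>)
  then show ?thesis using True by (simp add: card_S power_numeral_reduce)
next
  case False
  have L: "joint_zeros L M L = int p ^ 3" and M: "joint_zeros L M M = int p ^ 3"
    unfolding joint_zeros_def using card_ker2[OF assms(2,3) False] by (simp_all add: conj_ac)
  have K: "joint_zeros L M K = int p ^ 2" if "K \<in> S - {L, M}" for K
    unfolding joint_zeros_def using card_ker3[OF assms, of K] False that by auto
  have "(\<Sum>K\<in>S. joint_zeros L M K) = int (card {L, M}) * int p ^ 3 + (int (card S) - int (card {L, M})) * int p ^ 2"
    by (rule sum_two_values) (use assms L M K in auto)
  then show ?thesis using False by (simp add: card_S algebra_simps)
qed

text \<open>Double counting: a power of \<open>N h\<close> is expanded into indicators, and the sum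
  over \<open>h\<close> is taken first. The lower moments repeat an indicator, so that
  \<open>joint_zeros\<close> serves all three.\<close>

lemma moments:
  assumes "odd p"
  shows "(\<Sum>h\<in>UNIV. int (N h)) = (int p ^ 2 + 1) * int p ^ 4"
    "(\<Sum>h\<in>UNIV. int (N h) ^ 2) = (int p ^ 2 + 1) * (int p ^ 4 + int p ^ 5)"
    "(\<Sum>h\<in>UNIV. int (N h) ^ 3) = (int p ^ 2 + 1) * (3 * int p ^ 5 + int p ^ 6)"
proof -
  have c: "joint_zeros L L L = int p ^ 4" if "L \<in> S" for L unfolding joint_zeros_def using card_ker1[OF that] by simp
  have "(\<Sum>h\<in>UNIV. int (N h)) = (\<Sum>h\<in>UNIV. \<Sum>L\<in>S. of_bool (ev h L = 0) * of_bool (ev h L = 0) * of_bool (ev h L = 0))"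
    unfolding N_eq_sum by (simp add: of_bool_conj[symmetric])
  also have "\<dots> = (\<Sum>L\<in>S. joint_zeros L L L)" unfolding sum_joint_zeros_eq[symmetric] by (rule sum.swap)
  also have "\<dots> = (\<Sum>L\<in>S. int p ^ 4)" by (rule sum.cong) (use c in auto)
  finally show "(\<Sum>h\<in>UNIV. int (N h)) = (int p ^ 2 + 1) * int p ^ 4" by (simp add: card_S)
  have "(\<Sum>h\<in>UNIV. int (N h) ^ 2) =
      (\<Sum>h\<in>UNIV. \<Sum>L\<in>S. \<Sum>K\<in>S. of_bool (ev h L = 0) * of_bool (ev h L = 0) * of_bool (ev h K = 0))"
    unfolding N_eq_sum power2_eq_square sum_product by (simp add: of_bool_conj[symmetric])
  also have "\<dots> = (\<Sum>L\<in>S. \<Sum>h\<in>UNIV. \<Sum>K\<in>S. of_bool (ev h L = 0) * of_bool (ev h L = 0) * of_bool (ev h K = 0))"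
    by (rule sum.swap)
  also have "\<dots> = (\<Sum>L\<in>S. \<Sum>K\<in>S. joint_zeros L L K)"
    unfolding sum_joint_zeros_eq[symmetric] by (rule sum.cong[OF refl sum.swap])
  also have "\<dots> = (\<Sum>L\<in>S. int p ^ 4 + int p ^ 5)" by (rule sum.cong) (use sum_joint_zeros[OF assms] in auto)
  finally show "(\<Sum>h\<in>UNIV. int (N h) ^ 2) = (int p ^ 2 + 1) * (int p ^ 4 + int p ^ 5)" by (simp add: card_S)
  have "(\<Sum>h\<in>UNIV. int (N h) ^ 3) =
      (\<Sum>h\<in>UNIV. \<Sum>L\<in>S. \<Sum>M\<in>S. \<Sum>K\<in>S. of_bool (ev h L = 0) * of_bool (ev h M = 0) * of_bool (ev h K = 0))"
    unfolding N_eq_sum sum_cube ..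
  also have "\<dots> = (\<Sum>L\<in>S. \<Sum>h\<in>UNIV. \<Sum>M\<in>S. \<Sum>K\<in>S. of_bool (ev h L = 0) * of_bool (ev h M = 0) * of_bool (ev h K = 0))"
    by (rule sum.swap)
  also have "\<dots> = (\<Sum>L\<in>S. \<Sum>M\<in>S. \<Sum>h\<in>UNIV. \<Sum>K\<in>S. of_bool (ev h L = 0) * of_bool (ev h M = 0) * of_bool (ev h K = 0))"
    by (rule sum.cong[OF refl sum.swap])
  also have "\<dots> = (\<Sum>L\<in>S. \<Sum>M\<in>S. \<Sum>K\<in>S. joint_zeros L M K)"
    unfolding sum_joint_zeros_eq[symmetric] by (intro sum.cong refl, rule sum.swap)
  also have "\<dots> = (\<Sum>L\<in>S. \<Sum>M\<in>S. if L = M then int p ^ 4 + int p ^ 5 else 2 * int p ^ 3 + (int p ^ 2 - 1) * int p ^ 2)"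
    by (intro sum.cong refl) (use sum_joint_zeros[OF assms] in auto)
  also have "\<dots> = (\<Sum>L\<in>S. int (card {L}) * (int p ^ 4 + int p ^ 5) +
      (int (card S) - int (card {L})) * (2 * int p ^ 3 + (int p ^ 2 - 1) * int p ^ 2))"
    by (intro sum.cong refl sum_two_values) auto
  also have "\<dots> = (int p ^ 2 + 1) * (3 * int p ^ 5 + int p ^ 6)"
    by (simp add: card_S) (simp add: algebra_simps power_numeral_reduce)
  finally show "(\<Sum>h\<in>UNIV. int (N h) ^ 3) = (int p ^ 2 + 1) * (3 * int p ^ 5 + int p ^ 6)" .
qed

text \<open>The product \<open>(N h - 1) (N h - 1 - p) (p\<^sup>2 + 1 - N h)\<close> is never negative as \<open>N h \<equiv> 1\<close> modulo \<open>p\<close>, and the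
  moments show that it sums to \<open>0\<close>.\<close>

lemma N_values:
  assumes "odd p"
  shows "N h = 1 \<or> N h = p + 1 \<or> N h = p ^ 2 + 1"
proof -
  let ?q = "int p"
  define f where "f h = (int (N h) - 1) * (int (N h) - 1 - ?q) * (?q ^ 2 + 1 - int (N h))" for h
  have f: "f h = - (int (N h) ^ 3) + (?q ^ 2 + ?q + 3) * int (N h) ^ 2
      - ((?q + 2) * (?q ^ 2 + 1) + ?q + 1) * int (N h) + (?q + 1) * (?q ^ 2 + 1)" for h
    unfolding f_def by (simp add: algebra_simps power2_eq_square power3_eq_cube)
  have "(\<Sum>h\<in>UNIV. f h) = - ((?q ^ 2 + 1) * (3 * ?q ^ 5 + ?q ^ 6)) + (?q ^ 2 + ?q + 3) * ((?q ^ 2 + 1) * (?q ^ 4 + ?q ^ 5))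
      - ((?q + 2) * (?q ^ 2 + 1) + ?q + 1) * ((?q ^ 2 + 1) * ?q ^ 4) + ?q ^ 5 * ((?q + 1) * (?q ^ 2 + 1))"
    unfolding f sum.distrib sum_subtractf sum_negf sum_distrib_left[symmetric] moments[OF assms] sum_constant card_params
    by (simp add: algebra_simps power_numeral_reduce)
  also have "\<dots> = 0" by (simp add: algebra_simps power_numeral_reduce)
  finally have sum: "(\<Sum>h\<in>UNIV. f h) = 0" .
  \<comment> \<open>With \<open>N h = 1 + p * m\<close> each of the three factors is a multiple of
    \<open>p\<close>; \<open>m * (m - 1)\<close> is nonnegative for every integer
    \<open>m\<close>.\<close>
  have fm: "f h = ?q ^ 3 * (int m * (int m - 1) * (?q - int m))" if "N h = 1 + p * m" for h m
    unfolding f_def that by (simp add: algebra_simps power2_eq_square power3_eq_cube)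
  have nonneg: "0 \<le> f h" for h
  proof -
    obtain m where m: "N h = 1 + p * m" "m \<le> p" using N_cases by blast
    have "0 \<le> int m * (int m - 1)" by (cases m) auto
    moreover have "0 \<le> ?q - int m" using m(2) by simp
    ultimately have "0 \<le> int m * (int m - 1) * (?q - int m)" by (rule mult_nonneg_nonneg)
    then show ?thesis unfolding fm[OF m(1)] by (rule mult_nonneg_nonneg[rotated]) simp
  qed
  have "\<forall>h\<in>UNIV. f h = 0"
    by (rule iffD1[OF sum_nonneg_eq_0_iff sum]) (rule finite, rule nonneg)
  then have "f h = 0" by blast
  moreover obtain m where m: "N h = 1 + p * m" "m \<le> p" using N_cases by blast
  ultimately have "int m = 0 \<or> int m = 1 \<or> ?q = int m" unfolding fm[OF m(1)] using p_pos by auto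
  then have "m = 0 \<or> m = 1 \<or> m = p" by linarith
  then show ?thesis unfolding m(1) by (auto simp: power2_eq_square)
qed

text \<open>The product \<open>(N h - 1) (N h - 1 - p)\<close> is nonzero only for
  \<open>N h = p\<^sup>2 + 1\<close>. By the first two moments it sums to
  \<open>p ^ 4 * (p - 1)\<close>, while \<open>h = 0\<close> contributes only
  \<open>p ^ 3 * (p - 1)\<close>, so some other form contributes as well.\<close>

lemma exists_hyperplane:
  assumes "odd p"
  obtains h where "h \<noteq> 0" "\<And>L. L \<in> S \<Longrightarrow> ev h L = 0"
proof -
  let ?q = "int p"
  define f where "f h = (int (N h) - 1) * (int (N h) - 1 - ?q)" for h
  have f: "f h = int (N h) ^ 2 - (?q + 2) * int (N h) + (?q + 1)" for h
    unfolding f_def by (simp add: algebra_simps power2_eq_square)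
  have "(\<Sum>h\<in>UNIV. f h) = (?q ^ 2 + 1) * (?q ^ 4 + ?q ^ 5) - (?q + 2) * ((?q ^ 2 + 1) * ?q ^ 4) + ?q ^ 5 * (?q + 1)"
    unfolding f sum.distrib sum_subtractf sum_distrib_left[symmetric] moments[OF assms] sum_constant card_params
    by (simp add: algebra_simps power_numeral_reduce)
  also have "\<dots> = ?q ^ 4 * (?q - 1)" by (simp add: algebra_simps power_numeral_reduce)
  finally have sum: "(\<Sum>h\<in>UNIV. f h) = ?q ^ 4 * (?q - 1)" .
  have "\<exists>h. h \<noteq> 0 \<and> N h = p ^ 2 + 1"
  proof (rule ccontr)
    assume "\<not> ?thesis"
    then have "N h \<noteq> p ^ 2 + 1" if "h \<noteq> 0" for h using that by blast
    then have "f h = 0" if "h \<noteq> 0" for h using that N_values[OF assms, of h] unfolding f_def by fastforce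
    then have "(\<Sum>h\<in>UNIV. f h) = f 0" using sum.remove[of UNIV 0 f] by simp
    moreover have "ev 0 L = 0" for L by (simp add: zero_prod_def form5_def form6_def)
    then have "N 0 = p ^ 2 + 1" unfolding N_def by (simp add: card_S)
    then have "f 0 = ?q ^ 3 * (?q - 1)" unfolding f_def by (simp add: algebra_simps power_numeral_reduce)
    ultimately have "?q ^ 3 * (?q - 1) * (?q - 1) = 0" using sum by (simp add: algebra_simps power_numeral_reduce)
    then show False using prime_gt_1_nat[OF prime_p] by simp
  qed
  then obtain h where h: "h \<noteq> 0" "N h = p ^ 2 + 1" by blast
  then have "{L\<in>S. ev h L = 0} = S"
    unfolding N_def card_S[symmetric] by (intro card_subset_eq) auto
  then have "ev h L = 0" if "L \<in> S" for L using that by blast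
  with h(1) that show ?thesis by blast
qed

end

section \<open>Two spreads share a plane\<close>

text \<open>The matrix of the form times that of its dual form is, up to sign, the Pfaffian times
  the identity. Hence the Pfaffian kills every coordinate of a vector in the radical; the four
  identities in the proof are the rows of this product.\<close>

lemma pfaffian_zero_if_degenerate:
  fixes x :: "'a::field pt"
  assumes "\<And>e. form6 h01 h02 h03 h12 h13 h23 e x = 0" "x \<noteq> 0"
  shows "h01 * h23 - h02 * h13 + h03 * h12 = 0"
proof -
  let ?H = "form6 h01 h02 h03 h12 h13 h23"
  have "?H (vector [1, 0], vector [0, 0]) x = 0" "?H (vector [0, 1], vector [0, 0]) x = 0"
    "?H (vector [0, 0], vector [1, 0]) x = 0" "?H (vector [0, 0], vector [0, 1]) x = 0"
    by (rule assms(1))+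
  then have E: "h01 * fst x $ 2 + h02 * snd x $ 1 + h03 * snd x $ 2 = 0"
    "- h01 * fst x $ 1 + h12 * snd x $ 1 + h13 * snd x $ 2 = 0"
    "- h02 * fst x $ 1 - h12 * fst x $ 2 + h23 * snd x $ 2 = 0"
    "- h03 * fst x $ 1 - h13 * fst x $ 2 - h23 * snd x $ 1 = 0"
    by (simp_all add: form6_def pl_defs)
  let ?pf = "h01 * h23 - h02 * h13 + h03 * h12"
  have "?pf * fst x $ 1 = - h23 * (- h01 * fst x $ 1 + h12 * snd x $ 1 + h13 * snd x $ 2)
    + h13 * (- h02 * fst x $ 1 - h12 * fst x $ 2 + h23 * snd x $ 2)
    - h12 * (- h03 * fst x $ 1 - h13 * fst x $ 2 - h23 * snd x $ 1)"
    by (simp add: algebra_simps)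
  moreover have "?pf * fst x $ 2 = h23 * (h01 * fst x $ 2 + h02 * snd x $ 1 + h03 * snd x $ 2)
    - h03 * (- h02 * fst x $ 1 - h12 * fst x $ 2 + h23 * snd x $ 2)
    + h02 * (- h03 * fst x $ 1 - h13 * fst x $ 2 - h23 * snd x $ 1)"
    by (simp add: algebra_simps)
  moreover have "?pf * snd x $ 1 = - h13 * (h01 * fst x $ 2 + h02 * snd x $ 1 + h03 * snd x $ 2)
    + h03 * (- h01 * fst x $ 1 + h12 * snd x $ 1 + h13 * snd x $ 2)
    - h01 * (- h03 * fst x $ 1 - h13 * fst x $ 2 - h23 * snd x $ 1)"
    by (simp add: algebra_simps)
  moreover have "?pf * snd x $ 2 = h12 * (h01 * fst x $ 2 + h02 * snd x $ 1 + h03 * snd x $ 2)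
    - h02 * (- h01 * fst x $ 1 + h12 * snd x $ 1 + h13 * snd x $ 2)
    + h01 * (- h02 * fst x $ 1 - h12 * fst x $ 2 + h23 * snd x $ 2)"
    by (simp add: algebra_simps)
  ultimately have "?pf * fst x $ 1 = 0" "?pf * fst x $ 2 = 0" "?pf * snd x $ 1 = 0" "?pf * snd x $ 2 = 0"
    unfolding E by simp_all
  then show ?thesis using assms(2) unfolding pt_eq_iff by (metis fst_zero snd_zero zero_index mult_eq_0_iff)
qed

lemma spread_based:
  fixes S :: "'p::prime_card mod_ring pt set set"
  assumes "spread S"
  obtains A B where "based_spread S A B CARD('p)"
proof -
  have "\<forall>L\<in>S. \<exists>ab. omega (fst ab) (snd ab) = 0 \<and> indep (fst ab) (snd ab) \<and> L = span2 (fst ab) (snd ab)"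
    using assms unfolding spread_def lagrangian_def by (metis fst_conv snd_conv)
  then obtain ab where "\<forall>L\<in>S. omega (fst (ab L)) (snd (ab L)) = 0 \<and> indep (fst (ab L)) (snd (ab L))
      \<and> L = span2 (fst (ab L)) (snd (ab L))"
    by (rule bchoice[THEN exE])
  then have "based_spread S (fst \<circ> ab) (snd \<circ> ab) CARD('p)"
    unfolding based_spread_def using assms by simp
  then show ?thesis by (rule that)
qed

theorem spreads_meet:
  fixes S T :: "'p::prime_card mod_ring pt set set"
  assumes "spread S" "spread T" "odd CARD('p)"
  shows "S \<inter> T \<noteq> {}"
proof -
  obtain A B where S: "based_spread S A B CARD('p)" using spread_based[OF assms(1)] .
  obtain A' B' where T: "based_spread T A' B' CARD('p)" using spread_based[OF assms(2)] .
  interpret S: based_spread S A B "CARD('p)" by (rule S)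
  interpret T: based_spread T A' B' "CARD('p)" by (rule T)
  obtain h where h: "h \<noteq> 0" "\<And>L. L \<in> S \<Longrightarrow> S.ev h L = 0" using S.exists_hyperplane[OF assms(3)] by blast
  obtain h01 h02 h03 h12 h23 where hh: "h = (h01, h02, h03, h12, h23)" by (cases h) auto
  \<comment> \<open>A degenerate translate would bound the number of members on which
    \<open>h\<close> vanishes by \<open>p + 1\<close>, but \<open>h\<close> vanishes on all
    \<open>p\<^sup>2 + 1\<close>.\<close>
  have nondeg: "l ^ 2 - h02 * l \<noteq> h01 * h23 + h03 * h12" for l
  proof
    assume "l ^ 2 - h02 * l = h01 * h23 + h03 * h12"
    from S.N_degenerate(2)[OF this] h(1) have "S.N h \<le> CARD('p) + 1" unfolding hh by simp
    moreover have "S.N h = card S" unfolding S.N_def using h(2) by (intro arg_cong[where f = card]) auto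
    ultimately show False using S.card_S prime_gt_1_nat[OF S.prime_p] by (simp add: power2_eq_square)
  qed
  have "T.N h \<noteq> 0" using T.N_cases[of h] by auto
  then have "{P\<in>T. T.ev h P = 0} \<noteq> {}" unfolding T.N_def by (metis card.empty)
  then obtain P where P: "P \<in> T" "T.ev h P = 0" by blast
  let ?x = "A' P"
  have x: "?x \<in> P" "?x \<noteq> 0"
  proof -
    show "?x \<in> P" using T.base(3)[OF P(1)] generators_in_span2(1) by blast
    show "?x \<noteq> 0"
    proof
      assume "?x = 0"
      then have "comb ?x (B' P) 1 0 = 0" by (simp only: comb_algebra)
      then have "(1 :: 'p mod_ring) = 0" using T.base(2)[OF P(1)] unfolding indep_def by blast
      then show False by simp
    qed
  qed
  obtain L where L: "L \<in> S" "?x \<in> L" using assms(1) x(2) unfolding spread_def by blast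
  \<comment> \<open>Both \<open>L\<close> and \<open>P\<close> contain \<open>?x\<close>, and both
    forms vanish on both planes, so both lie in \<open>?Z\<close>. Once \<open>?Z\<close> is known
    to have \<open>p\<^sup>2\<close> elements, they coincide with it.\<close>
  let ?Z = "{y. omega y ?x = 0 \<and> form5 h y ?x = 0}"
  have alt: "alt_form omega" unfolding form6_omega by (rule alt_form_form6)
  have LZ: "L \<subseteq> ?Z"
  proof -
    have "vanishes_on omega L" "vanishes_on (form5 h) L"
      using vanishes_on_span2_iff[OF alt] vanishes_on_span2_iff[OF alt_form_form5] S.base[OF L(1)] h(2)[OF L(1)] by metis+
    then show ?thesis using L(2) unfolding vanishes_on_def by blast
  qed
  have PZ: "P \<subseteq> ?Z"
  proof -
    have "vanishes_on omega P" "vanishes_on (form5 h) P"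
      using vanishes_on_span2_iff[OF alt] vanishes_on_span2_iff[OF alt_form_form5] T.base[OF P(1)] P(2) by metis+
    then show ?thesis using x(1) unfolding vanishes_on_def by blast
  qed
  \<comment> \<open>If the two functionals were proportional, \<open>?x\<close> would lie in the
    radical of some \<open>h - l * omega\<close>, whose Pfaffian \<open>nondeg\<close> excludes from
    being zero. The functional of \<open>omega\<close> is itself nonzero, since \<open>omega\<close>
    has Pfaffian -1.\<close>
  have "\<exists>e f. omega e ?x * form5 h f ?x \<noteq> omega f ?x * form5 h e ?x"
  proof (rule ccontr)
    assume "\<not> ?thesis"
    then have eq: "omega e ?x * form5 h f ?x = omega f ?x * form5 h e ?x" for e f by blast
    have "\<exists>e. omega e ?x \<noteq> 0"
    proof (rule ccontr)
      assume "\<not> ?thesis"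
      then have "form6 0 1 0 0 1 0 e ?x = 0" for e unfolding form6_omega by blast
      from pfaffian_zero_if_degenerate[OF this x(2)] show False by simp
    qed
    then obtain e where e: "omega e ?x \<noteq> 0" by blast
    define l where "l = form5 h e ?x / omega e ?x"
    have "form5 h f ?x = l * omega f ?x" for f
      using eq[of e f] e unfolding l_def by (simp add: field_simps)
    then have "form6 h01 (h02 - l) h03 h12 (- l) h23 f ?x = 0" for f
      unfolding hh by (simp add: form5_def form6_def omega_def algebra_simps)
    from pfaffian_zero_if_degenerate[OF this x(2)] nondeg[of l] show False
      by (simp add: algebra_simps power2_eq_square)
  qed
  then obtain e f where "omega e ?x * form5 h f ?x \<noteq> omega f ?x * form5 h e ?x" by blast
  from card_common_zeros[OF alt_form_lin(1)[OF alt] alt_form_lin(1)[OF alt_form_form5] this]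
  have Z: "card ?Z = CARD('p) ^ 2" by simp
  have "lagrangian L" "lagrangian P" using assms(1,2) L(1) P(1) unfolding spread_def by blast+
  then have "card L = card ?Z" "card P = card ?Z" using Z by (simp_all add: card_lagrangian)
  then have eqs: "L = ?Z" "P = ?Z" using LZ PZ by (simp_all add: card_subset_eq)
  have "L = P" by (rule trans[OF eqs(1) eqs(2)[symmetric]])
  then have "L \<in> S \<inter> T" using L(1) P(1) by (intro IntI) (assumption, rule ssubst)
  then show ?thesis by (metis empty_iff)
qed

section \<open>The blocks as Lagrangian cosets\<close>

text \<open>Here and for the other families, defining equations replace the parametrisation, so that
  translation and membership become matters of simplification.\<close>

definition block0 :: "'a::field ^ 2 \<Rightarrow> 'a pt set" where
  "block0 k = {x. fst x = k}"
definition block1 :: "'a::field ^ 2 ^ 2 \<Rightarrow> 'a ^ 2 \<Rightarrow> 'a pt set" where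
  "block1 A b = {x. snd x = A *v fst x + b}"
definition block2 :: "'a::field \<Rightarrow> 'a \<Rightarrow> 'a \<Rightarrow> 'a pt set" where
  "block2 a b c = {x. fst x $ 1 = c \<and> snd x $ 2 = a * fst x $ 2 + b}"
definition block3 :: "'a::field \<Rightarrow> 'a \<Rightarrow> 'a \<Rightarrow> 'a pt set" where
  "block3 a b c = {x. fst x $ 2 = c \<and> snd x $ 1 = a * fst x $ 1 + b}"
definition block4 :: "'a::field \<Rightarrow> 'a \<Rightarrow> 'a \<Rightarrow> 'a \<Rightarrow> 'a pt set" where
  "block4 \<alpha> \<beta> a b = {x. fst x $ 2 = \<alpha> * fst x $ 1 + \<beta> \<and> snd x $ 2 = (- 1 / \<alpha>) * snd x $ 1 + a * fst x $ 1 + b}"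

lemmas block_defs = block0_def block1_def block2_def block3_def block4_def

lemma B0_eq: "(\<B>0 :: 'p::prime_card point blocks) = image_mset block0 (mset_set UNIV)"
proof -
  have "{(k, \<kappa>) | \<kappa>. True} = block0 k" for k :: "'p mod_ring ^ 2" by (auto simp: block0_def)
  then show ?thesis unfolding \<B>0_def by simp
qed

lemma B1_eq: "(\<B>1 :: 'p::prime_card point blocks) = image_mset (\<lambda>(A, b). block1 A b) (mset_set (Sym2 \<times> UNIV))"
proof -
  have "{(k, A *v k + b) | k. True} = block1 A b" for A and b :: "'p mod_ring ^ 2" by (auto simp: block1_def)
  then show ?thesis unfolding \<B>1_def by simp
qed

lemma B2_eq: "(\<B>2 :: 'p::prime_card point blocks) = image_mset (\<lambda>(a, b, c). block2 a b c) (mset_set UNIV)"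
proof -
  have "{(vector [c, k\<^sub>1], vector [\<kappa>\<^sub>0, a * k\<^sub>1 + b]) | k\<^sub>1 \<kappa>\<^sub>0. True} = block2 a b c" for a b c :: "'p mod_ring"
  proof (intro equalityI subsetI)
    fix x assume "x \<in> block2 a b c"
    then have "x = (vector [c, fst x $ 2], vector [snd x $ 1, a * fst x $ 2 + b])"
      by (simp add: block2_def pt_eq_iff)
    then show "x \<in> {(vector [c, k\<^sub>1], vector [\<kappa>\<^sub>0, a * k\<^sub>1 + b]) | k\<^sub>1 \<kappa>\<^sub>0. True}" by blast
  qed (auto simp: block2_def)
  then show ?thesis unfolding \<B>2_def by simp
qed

lemma B3_eq: "(\<B>3 :: 'p::prime_card point blocks) = image_mset (\<lambda>(a, b, c). block3 a b c) (mset_set UNIV)"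
proof -
  have "{(vector [k\<^sub>0, c], vector [a * k\<^sub>0 + b, \<kappa>\<^sub>1]) | k\<^sub>0 \<kappa>\<^sub>1. True} = block3 a b c" for a b c :: "'p mod_ring"
  proof (intro equalityI subsetI)
    fix x assume "x \<in> block3 a b c"
    then have "x = (vector [fst x $ 1, c], vector [a * fst x $ 1 + b, snd x $ 2])"
      by (simp add: block3_def pt_eq_iff)
    then show "x \<in> {(vector [k\<^sub>0, c], vector [a * k\<^sub>0 + b, \<kappa>\<^sub>1]) | k\<^sub>0 \<kappa>\<^sub>1. True}" by blast
  qed (auto simp: block3_def)
  then show ?thesis unfolding \<B>3_def by simp
qed

lemma B4_eq: "(\<B>4 :: 'p::prime_card point blocks) =
  image_mset (\<lambda>(\<alpha>, \<beta>, a, b). block4 \<alpha> \<beta> a b) (mset_set {(\<alpha>, \<beta>, a, b). \<alpha> \<noteq> 0})"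
proof -
  have "{(vector [k\<^sub>0, \<alpha> * k\<^sub>0 + \<beta>], vector [\<kappa>\<^sub>0, (- 1 / \<alpha>) * \<kappa>\<^sub>0 + a * k\<^sub>0 + b]) | k\<^sub>0 \<kappa>\<^sub>0. True} = block4 \<alpha> \<beta> a b"
    for \<alpha> \<beta> a b :: "'p mod_ring"
  proof (intro equalityI subsetI)
    fix x assume "x \<in> block4 \<alpha> \<beta> a b"
    then have "x = (vector [fst x $ 1, \<alpha> * fst x $ 1 + \<beta>], vector [snd x $ 1, (- 1 / \<alpha>) * snd x $ 1 + a * fst x $ 1 + b])"
      by (simp add: block4_def pt_eq_iff)
    then show "x \<in> {(vector [k\<^sub>0, \<alpha> * k\<^sub>0 + \<beta>], vector [\<kappa>\<^sub>0, (- 1 / \<alpha>) * \<kappa>\<^sub>0 + a * k\<^sub>0 + b]) | k\<^sub>0 \<kappa>\<^sub>0. True}" by blast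
  qed (auto simp: block4_def)
  then show ?thesis unfolding \<B>4_def by simp
qed

lemma Sym2_iff: "A \<in> Sym2 \<longleftrightarrow> A $ 1 $ 2 = A $ 2 $ 1"
  unfolding Sym2_def by (auto simp: vec_eq_iff forall_2 transpose_def)

lemma mult_vec_2:
  fixes A :: "'a::field ^ 2 ^ 2"
  shows "(A *v k) $ 1 = A $ 1 $ 1 * k $ 1 + A $ 1 $ 2 * k $ 2" "(A *v k) $ 2 = A $ 2 $ 1 * k $ 1 + A $ 2 $ 2 * k $ 2"
  by (simp_all add: matrix_vector_mult_def sum_2)

text \<open>The functions \<open>f\<close> and \<open>g\<close> read off the coordinates of
  \<open>w\<close> in the basis \<open>a\<close>, \<open>b\<close>.\<close>

lemma lagrangianI:
  assumes "omega a b = 0" "indep a b" "\<And>w. w \<in> L \<Longrightarrow> w = comb a b (f w) (g w)" "\<And>c d. comb a b c d \<in> L"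
  shows "lagrangian L"
proof -
  have "L = span2 a b" unfolding span2_def using assms(3,4) by blast
  with assms(1,2) show ?thesis unfolding lagrangian_def by blast
qed

lemma lagrangian_block0: "lagrangian {w. w + z \<in> block0 k}" if "z \<in> block0 k"
  by (rule lagrangianI[where a = "(vector [0, 0], vector [1, 0])" and b = "(vector [0, 0], vector [0, 1])"
        and f = "\<lambda>w. snd w $ 1" and g = "\<lambda>w. snd w $ 2"])
    (use that in \<open>simp_all add: block0_def omega_def pl_defs indep_def pt_eq_iff comb_simps vec_eq_iff forall_2\<close>)

text \<open>The direction is the graph of \<open>A\<close>; \<open>omega\<close> of the two basis
  vectors is \<open>A $ 1 $ 2 - A $ 2 $ 1\<close>, so symmetry of \<open>A\<close> is exactly
  isotropy.\<close>

lemma lagrangian_block1: "lagrangian {w. w + z \<in> block1 A b}" if "z \<in> block1 A b" "A $ 1 $ 2 = A $ 2 $ 1"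
  by (rule lagrangianI[where a = "(vector [1, 0], vector [A $ 1 $ 1, A $ 2 $ 1])" and b = "(vector [0, 1], vector [A $ 1 $ 2, A $ 2 $ 2])"
        and f = "\<lambda>w. fst w $ 1" and g = "\<lambda>w. fst w $ 2"])
    (use that in \<open>simp_all add: block1_def omega_def pl_defs indep_def pt_eq_iff comb_simps vec_eq_iff forall_2 mult_vec_2 algebra_simps\<close>)

lemma lagrangian_block2: "lagrangian {w. w + z \<in> block2 a b c}" if "z \<in> block2 a b c"
  by (rule lagrangianI[where a = "(vector [0, 1], vector [0, a])" and b = "(vector [0, 0], vector [1, 0])"
        and f = "\<lambda>w. fst w $ 2" and g = "\<lambda>w. snd w $ 1"])
    (use that in \<open>simp_all add: block2_def omega_def pl_defs indep_def pt_eq_iff comb_simps algebra_simps\<close>)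

lemma lagrangian_block3: "lagrangian {w. w + z \<in> block3 a b c}" if "z \<in> block3 a b c"
  by (rule lagrangianI[where a = "(vector [1, 0], vector [a, 0])" and b = "(vector [0, 0], vector [0, 1])"
        and f = "\<lambda>w. fst w $ 1" and g = "\<lambda>w. snd w $ 2"])
    (use that in \<open>simp_all add: block3_def omega_def pl_defs indep_def pt_eq_iff comb_simps algebra_simps\<close>)

text \<open>The slope \<open>- 1 / \<alpha>\<close> makes the contribution of \<open>pl13\<close>
  equal to -1, which cancels the contribution 1 of \<open>pl02\<close>.\<close>

lemma lagrangian_block4: "lagrangian {w. w + z \<in> block4 \<alpha> \<beta> a b}" if z: "z \<in> block4 \<alpha> \<beta> a b" and "\<alpha> \<noteq> 0"
proof -
  have cancel: "m + (c * t + a * g + b) = c * (s + t) + a * (f + g) + b \<longleftrightarrow> m = c * s + a * f"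
    for m c t g s f :: 'a by (auto simp: algebra_simps)
  have zz: "fst z $ 2 = \<alpha> * fst z $ 1 + \<beta>" "snd z $ 2 = (- 1 / \<alpha>) * snd z $ 1 + a * fst z $ 1 + b"
    using z unfolding block4_def by blast+
  have "{w. w + z \<in> block4 \<alpha> \<beta> a b} = {w. fst w $ 2 = \<alpha> * fst w $ 1 \<and> snd w $ 2 = (- 1 / \<alpha>) * snd w $ 1 + a * fst w $ 1}"
    unfolding block4_def mem_Collect_eq fst_add snd_add vector_add_component zz cancel by (simp add: algebra_simps)
  moreover have "lagrangian \<dots>"
    by (rule lagrangianI[where a = "(vector [1, \<alpha>], vector [0, a])" and b = "(vector [0, 0], vector [1, - 1 / \<alpha>])"
          and f = "\<lambda>w. fst w $ 1" and g = "\<lambda>w. snd w $ 1"])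
      (use \<open>\<alpha> \<noteq> 0\<close> in \<open>simp_all add: omega_def pl_defs indep_def pt_eq_iff comb_simps algebra_simps\<close>)
  ultimately show ?thesis by simp
qed

section \<open>Distinct parameters and distinct families give distinct blocks\<close>

lemma block_nonempty:
  fixes k b :: "'a::field ^ 2" and A :: "'a ^ 2 ^ 2" and a' b' c \<alpha> \<beta> :: 'a
  shows "block0 k \<noteq> {}" "block1 A b \<noteq> {}" "block2 a' b' c \<noteq> {}" "block3 a' b' c \<noteq> {}" "block4 \<alpha> \<beta> a' b' \<noteq> {}"
proof -
  have "(k, 0) \<in> block0 k" "(0, A *v 0 + b) \<in> block1 A b" "(vector [c, 0], vector [0, b']) \<in> block2 a' b' c"
    "(vector [0, c], vector [b', 0]) \<in> block3 a' b' c" "(vector [0, \<beta>], vector [0, b']) \<in> block4 \<alpha> \<beta> a' b'"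
    by (simp_all add: block_defs)
  then show "block0 k \<noteq> {}" "block1 A b \<noteq> {}" "block2 a' b' c \<noteq> {}" "block3 a' b' c \<noteq> {}" "block4 \<alpha> \<beta> a' b' \<noteq> {}" by blast+
qed

lemma inj_block0: "inj block0"
proof (rule injI)
  fix k k' :: "'a ^ 2" assume "block0 k = block0 k'"
  moreover have "(k, 0) \<in> block0 k" by (simp add: block0_def)
  ultimately have "(k, 0) \<in> block0 k'" by blast
  then show "k = k'" by (simp add: block0_def)
qed

lemma inj_block1: "inj (\<lambda>(A, b). block1 A b)"
proof (rule injI, clarify)
  fix A A' :: "'a ^ 2 ^ 2" and b b' assume eq: "block1 A b = block1 A' b'"
  have *: "A *v k + b = A' *v k + b'" for k
  proof -
    have "(k, A *v k + b) \<in> block1 A b" by (simp add: block1_def)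
    then have "(k, A *v k + b) \<in> block1 A' b'" unfolding eq .
    then show ?thesis by (simp add: block1_def)
  qed
  from *[of 0] have b: "b = b'" by simp
  with * have "A *v k = A' *v k" for k by simp
  then show "A = A' \<and> b = b'" using b by (simp add: matrix_eq)
qed

lemma inj_block2: "inj (\<lambda>(a, b, c). block2 a b c)"
proof (rule injI)
  fix s s' :: "'a \<times> 'a \<times> 'a" assume "(\<lambda>(a, b, c). block2 a b c) s = (\<lambda>(a, b, c). block2 a b c) s'"
  moreover obtain a b c a' b' c' where s: "s = (a, b, c)" "s' = (a', b', c')" by (cases s, cases s')
  ultimately have eq: "block2 a b c = block2 a' b' c'" by simp
  have "(vector [c, t], vector [0, a * t + b]) \<in> block2 a b c" for t by (simp add: block2_def)
  then have *: "(vector [c, t], vector [0, a * t + b]) \<in> block2 a' b' c'" for t unfolding eq .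
  from *[of 0] *[of 1] show "s = s'" unfolding s by (simp add: block2_def)
qed

lemma inj_block3: "inj (\<lambda>(a, b, c). block3 a b c)"
proof (rule injI)
  fix s s' :: "'a \<times> 'a \<times> 'a" assume "(\<lambda>(a, b, c). block3 a b c) s = (\<lambda>(a, b, c). block3 a b c) s'"
  moreover obtain a b c a' b' c' where s: "s = (a, b, c)" "s' = (a', b', c')" by (cases s, cases s')
  ultimately have eq: "block3 a b c = block3 a' b' c'" by simp
  have "(vector [t, c], vector [a * t + b, 0]) \<in> block3 a b c" for t by (simp add: block3_def)
  then have *: "(vector [t, c], vector [a * t + b, 0]) \<in> block3 a' b' c'" for t unfolding eq .
  from *[of 0] *[of 1] show "s = s'" unfolding s by (simp add: block3_def)
qed

lemma inj_block4: "inj (\<lambda>(\<alpha>, \<beta>, a, b). block4 \<alpha> \<beta> a b)"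
proof (rule injI)
  fix s s' :: "'a \<times> 'a \<times> 'a \<times> 'a"
  assume "(\<lambda>(\<alpha>, \<beta>, a, b). block4 \<alpha> \<beta> a b) s = (\<lambda>(\<alpha>, \<beta>, a, b). block4 \<alpha> \<beta> a b) s'"
  moreover obtain \<alpha> \<beta> a b \<alpha>' \<beta>' a' b' where s: "s = (\<alpha>, \<beta>, a, b)" "s' = (\<alpha>', \<beta>', a', b')"
    by (cases s, cases s')
  ultimately have eq: "block4 \<alpha> \<beta> a b = block4 \<alpha>' \<beta>' a' b'" by simp
  \<comment> \<open>With 0 as first coordinate of the second factor, the term with
    \<open>- 1 / \<alpha>\<close> drops out; \<open>t = 0\<close> then yields \<open>\<beta>\<close>
    and \<open>b\<close>, and \<open>t = 1\<close> yields \<open>\<alpha>\<close> and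
    \<open>a\<close>.\<close>
  have "(vector [t, \<alpha> * t + \<beta>], vector [0, a * t + b]) \<in> block4 \<alpha> \<beta> a b" for t by (simp add: block4_def)
  then have *: "(vector [t, \<alpha> * t + \<beta>], vector [0, a * t + b]) \<in> block4 \<alpha>' \<beta>' a' b'" for t unfolding eq .
  from *[of 0] *[of 1] show "s = s'" unfolding s by (simp add: block4_def)
qed

text \<open>The families are told apart by the projection of a block to the first factor.\<close>

lemma fst_image_block:
  fixes k b' :: "'a::field ^ 2" and A :: "'a ^ 2 ^ 2" and a b c \<alpha> \<beta> :: 'a
  shows "fst ` block0 k = {k}" "fst ` block1 A b' = UNIV" "fst ` block2 a b c = {v. v $ 1 = c}" "fst ` block3 a b c = {v. v $ 2 = c}"
  "fst ` block4 \<alpha> \<beta> a b = {v. v $ 2 = \<alpha> * v $ 1 + \<beta>}"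
proof -
  have im: "fst ` {x. P (fst x) (snd x)} = {v. \<exists>w. P v w}" for P :: "'a ^ 2 \<Rightarrow> 'a ^ 2 \<Rightarrow> bool"
    by (force simp: image_iff)
  show "fst ` block0 k = {k}" unfolding block0_def im[of "\<lambda>v w. v = k"] by simp
  show "fst ` block1 A b' = UNIV" unfolding block1_def im[of "\<lambda>v w. w = A *v v + b'"] by simp
  have 2: "\<exists>w::'a^2. w $ 2 = s" for s by (rule exI[of _ "vector [0, s]"]) simp
  have 1: "\<exists>w::'a^2. w $ 1 = s" for s by (rule exI[of _ "vector [s, 0]"]) simp
  have 3: "\<exists>w::'a^2. w $ 2 = (- 1 / \<alpha>) * w $ 1 + s + t" for s t by (rule exI[of _ "vector [0, s + t]"]) simp
  show "fst ` block2 a b c = {v. v $ 1 = c}" unfolding block2_def im[of "\<lambda>v w. v $ 1 = c \<and> w $ 2 = a * v $ 2 + b"] using 2 by simp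
  show "fst ` block3 a b c = {v. v $ 2 = c}" unfolding block3_def im[of "\<lambda>v w. v $ 2 = c \<and> w $ 1 = a * v $ 1 + b"] using 1 by simp
  show "fst ` block4 \<alpha> \<beta> a b = {v. v $ 2 = \<alpha> * v $ 1 + \<beta>}" 
    unfolding block4_def im[of "\<lambda>v w. v $ 2 = \<alpha> * v $ 1 + \<beta> \<and> w $ 2 = (- 1 / \<alpha>) * w $ 1 + a * v $ 1 + b"]
    using 3 by simp
qed

text \<open>The projections are a point, the whole plane, and lines on which the first coordinate is
  constant, the second is constant, or neither. The condition \<open>\<alpha> \<noteq> 0\<close>
  separates the last two kinds.\<close>

lemma blocks_distinct:
  fixes k b' :: "'a::field ^ 2" and A :: "'a ^ 2 ^ 2" and a a' b b'' c c' \<alpha> \<beta> :: 'a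
  shows "block0 k \<noteq> block1 A b'" "block0 k \<noteq> block2 a b c" "block0 k \<noteq> block3 a b c" "block0 k \<noteq> block4 \<alpha> \<beta> a b"
  "block1 A b' \<noteq> block2 a b c" "block1 A b' \<noteq> block3 a b c" "block1 A b' \<noteq> block4 \<alpha> \<beta> a b"
  "block2 a' b'' c' \<noteq> block3 a b c" "block2 a' b'' c' \<noteq> block4 \<alpha> \<beta> a b" "\<alpha> \<noteq> 0 \<Longrightarrow> block3 a' b'' c' \<noteq> block4 \<alpha> \<beta> a b"
proof -
  have sep: "X \<noteq> Y" if "v \<in> fst ` X" "v \<notin> fst ` Y" for X Y :: "'a pt set" and v using that by blast
  have sep': "X \<noteq> Y" if "v \<notin> fst ` X" "v \<in> fst ` Y" for X Y :: "'a pt set" and v using that by blast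
  show "block0 k \<noteq> block1 A b'" by (rule sep'[of "k + vector [1, 0]"]) (simp_all add: fst_image_block vec_eq_iff forall_2)
  show "block0 k \<noteq> block2 a b c" by (rule sep'[of "vector [c, k $ 2 + 1]"]) (simp_all add: fst_image_block vec_eq_iff forall_2)
  show "block0 k \<noteq> block3 a b c" by (rule sep'[of "vector [k $ 1 + 1, c]"]) (simp_all add: fst_image_block vec_eq_iff forall_2)
  show "block0 k \<noteq> block4 \<alpha> \<beta> a b"
    by (rule sep'[of "vector [k $ 1 + 1, \<alpha> * (k $ 1 + 1) + \<beta>]"]) (simp_all add: fst_image_block vec_eq_iff forall_2)
  show "block1 A b' \<noteq> block2 a b c" by (rule sep[of "vector [c + 1, 0]"]) (simp_all add: fst_image_block)
  show "block1 A b' \<noteq> block3 a b c" by (rule sep[of "vector [0, c + 1]"]) (simp_all add: fst_image_block)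
  show "block1 A b' \<noteq> block4 \<alpha> \<beta> a b" by (rule sep[of "vector [0, \<beta> + 1]"]) (simp_all add: fst_image_block)
  show "block2 a' b'' c' \<noteq> block3 a b c" by (rule sep[of "vector [c', c + 1]"]) (simp_all add: fst_image_block)
  show "block2 a' b'' c' \<noteq> block4 \<alpha> \<beta> a b" by (rule sep[of "vector [c', \<alpha> * c' + \<beta> + 1]"]) (simp_all add: fst_image_block)
  \<comment> \<open>The witness is chosen so that the line of \<open>block4\<close> has height
    \<open>c' - 1\<close> there instead of \<open>c'\<close>.\<close>
  show "block3 a' b'' c' \<noteq> block4 \<alpha> \<beta> a b" if "\<alpha> \<noteq> 0"
    by (rule sep[of "vector [(c' - \<beta> - 1) / \<alpha>, c']"]) (use that in \<open>simp_all add: fst_image_block field_simps\<close>)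
qed

section \<open>Counting the blocks through two points\<close>

lemma size_filter_image:
  assumes "finite I"
  shows "size (filter_mset P (image_mset f (mset_set I))) = card {i\<in>I. P (f i)}"
  using assms by (simp add: filter_mset_image_mset filter_mset_mset_set)

text \<open>Two linear equations for the three entries of a symmetric matrix leave one free
  parameter: the upper left entry if \<open>d $ 1 = 0\<close>, and the lower right one
  otherwise.\<close>

lemma card_symmetric_interpolation:
  fixes d e :: "'a::{field,finite} ^ 2"
  assumes "d \<noteq> 0"
  shows "card {A :: 'a ^ 2 ^ 2. A $ 1 $ 2 = A $ 2 $ 1 \<and> A *v d = e} = CARD('a)"
proof -
  let ?X = "{A :: 'a ^ 2 ^ 2. A $ 1 $ 2 = A $ 2 $ 1 \<and> A *v d = e}"
  have X: "A \<in> ?X \<longleftrightarrow> A $ 1 $ 2 = A $ 2 $ 1 \<and> A $ 1 $ 1 * d $ 1 + A $ 1 $ 2 * d $ 2 = e $ 1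
      \<and> A $ 2 $ 1 * d $ 1 + A $ 2 $ 2 * d $ 2 = e $ 2" for A
    by (simp add: vec_eq_iff forall_2 mult_vec_2)
  have "\<exists>f. bij_betw f (UNIV :: 'a set) ?X"
  proof (cases "d $ 1 = 0")
    case True
    then have d2: "d $ 2 \<noteq> 0" using assms by (auto simp: vec_eq_iff forall_2)
    let ?f = "\<lambda>s. vector [vector [s, e $ 1 / d $ 2], vector [e $ 1 / d $ 2, e $ 2 / d $ 2]] :: 'a ^ 2 ^ 2"
    have "bij_betw ?f UNIV ?X"
    proof (rule bij_betwI[where g = "\<lambda>A. A $ 1 $ 1"])
      show "?f \<in> UNIV \<rightarrow> ?X" unfolding Pi_def X using True d2 by simp
      show "?f (A $ 1 $ 1) = A" if "A \<in> ?X" for A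
        using that True d2 unfolding X by (auto simp: vec_eq_iff forall_2 field_simps)
    qed simp_all
    then show ?thesis by blast
  next
    case False
    let ?t = "\<lambda>s. (e $ 2 - s * d $ 2) / d $ 1"
    let ?f = "\<lambda>s. vector [vector [(e $ 1 - ?t s * d $ 2) / d $ 1, ?t s], vector [?t s, s]] :: 'a ^ 2 ^ 2"
    have "bij_betw ?f UNIV ?X"
    proof (rule bij_betwI[where g = "\<lambda>A. A $ 2 $ 2"])
      show "?f \<in> UNIV \<rightarrow> ?X" unfolding Pi_def X using False by simp
      show "?f (A $ 2 $ 2) = A" if "A \<in> ?X" for A
      proof -
        have A: "A $ 1 $ 2 = A $ 2 $ 1" "A $ 1 $ 1 * d $ 1 + A $ 1 $ 2 * d $ 2 = e $ 1"
          "A $ 2 $ 1 * d $ 1 + A $ 2 $ 2 * d $ 2 = e $ 2" using that unfolding X by blast+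
        have t: "?t (A $ 2 $ 2) = A $ 2 $ 1" using False unfolding A(3)[symmetric] by simp
        have "(e $ 1 - A $ 2 $ 1 * d $ 2) / d $ 1 = A $ 1 $ 1" using False unfolding A(2)[symmetric] A(1) by simp
        with t A(1) show ?thesis by (simp add: vec_eq_iff forall_2)
      qed
    qed simp_all
    then show ?thesis by blast
  qed
  then obtain f where "bij_betw f (UNIV :: 'a set) ?X" by blast
  from bij_betw_same_card[OF this] show ?thesis by (rule sym)
qed

lemma count_block0: "card {k. x \<in> block0 k \<and> y \<in> block0 k} = (if fst x = fst y then 1 else 0)"
proof -
  have "{k. x \<in> block0 k \<and> y \<in> block0 k} = (if fst x = fst y then {fst x} else {})" by (auto simp: block0_def)
  then show ?thesis by simp
qed

text \<open>The vector \<open>b\<close> is determined by \<open>A\<close>, and \<open>A\<close> only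
  has to map the difference of the first components to that of the second.\<close>

lemma count_block1:
  fixes x y :: "'p::prime_card point"
  assumes "x \<noteq> y"
  shows "card {s \<in> Sym2 \<times> UNIV. x \<in> (\<lambda>(A, b). block1 A b) s \<and> y \<in> (\<lambda>(A, b). block1 A b) s} = (if fst x = fst y then 0 else CARD('p))"
proof (cases "fst x = fst y")
  case True
  then have "{s \<in> Sym2 \<times> UNIV. x \<in> (\<lambda>(A, b). block1 A b) s \<and> y \<in> (\<lambda>(A, b). block1 A b) s} = {}"
    using assms by (auto simp: block1_def prod_eq_iff)
  then show ?thesis using True by simp
next
  case False
  let ?X = "{A :: 'p mod_ring ^ 2 ^ 2. A $ 1 $ 2 = A $ 2 $ 1 \<and> A *v (fst x - fst y) = snd x - snd y}"
  have "bij_betw (\<lambda>A. (A, snd x - A *v fst x)) ?X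
    {s \<in> Sym2 \<times> UNIV. x \<in> (\<lambda>(A, b). block1 A b) s \<and> y \<in> (\<lambda>(A, b). block1 A b) s}"
    by (rule bij_betwI[where g = fst])
      (auto simp: Sym2_iff block1_def matrix_vector_mult_diff_distrib algebra_simps)
  then show ?thesis using False card_symmetric_interpolation[of "fst x - fst y" "snd x - snd y"]
    by (simp add: bij_betw_same_card[symmetric])
qed

lemma count_block2:
  fixes x y :: "'p::prime_card point"
  shows "card {s. x \<in> (\<lambda>(a, b, c). block2 a b c) s \<and> y \<in> (\<lambda>(a, b, c). block2 a b c) s} =
    (if fst x $ 1 = fst y $ 1 then if fst x $ 2 = fst y $ 2 then if snd x $ 2 = snd y $ 2 then CARD('p) else 0 else 1 else 0)"
    (is "card ?X = _")
proof -
  have X: "?X = (\<lambda>a. (a, snd x $ 2 - a * fst x $ 2, fst x $ 1)) `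
      {a. fst x $ 1 = fst y $ 1 \<and> a * (fst x $ 2 - fst y $ 2) = snd x $ 2 - snd y $ 2}"
    by (auto simp: block2_def image_iff algebra_simps)
  have "card ?X = card {a. fst x $ 1 = fst y $ 1 \<and> a * (fst x $ 2 - fst y $ 2) = snd x $ 2 - snd y $ 2}"
    unfolding X by (rule card_image) (auto simp: inj_on_def)
  moreover have "{a. a * d = e} = {e / d}" if "d \<noteq> 0" for d e :: "'p mod_ring" using that by (auto simp: field_simps)
  ultimately show ?thesis by auto
qed

lemma count_block3:
  fixes x y :: "'p::prime_card point"
  shows "card {s. x \<in> (\<lambda>(a, b, c). block3 a b c) s \<and> y \<in> (\<lambda>(a, b, c). block3 a b c) s} =
    (if fst x $ 2 = fst y $ 2 then if fst x $ 1 = fst y $ 1 then if snd x $ 1 = snd y $ 1 then CARD('p) else 0 else 1 else 0)"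
    (is "card ?X = _")
proof -
  have X: "?X = (\<lambda>a. (a, snd x $ 1 - a * fst x $ 1, fst x $ 2)) `
      {a. fst x $ 2 = fst y $ 2 \<and> a * (fst x $ 1 - fst y $ 1) = snd x $ 1 - snd y $ 1}"
    by (auto simp: block3_def image_iff algebra_simps)
  have "card ?X = card {a. fst x $ 2 = fst y $ 2 \<and> a * (fst x $ 1 - fst y $ 1) = snd x $ 1 - snd y $ 1}"
    unfolding X by (rule card_image) (auto simp: inj_on_def)
  moreover have "{a. a * d = e} = {e / d}" if "d \<noteq> 0" for d e :: "'p mod_ring" using that by (auto simp: field_simps)
  ultimately show ?thesis by auto
qed

text \<open>The parameters \<open>\<beta>\<close> and \<open>b\<close> are determined by the others,
  leaving \<open>d1 = \<alpha> * d0\<close> and \<open>e1 = - e0 / \<alpha> + a * d0\<close>. For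
  \<open>d0 \<noteq> 0\<close> these have a unique solution as long as \<open>d1 \<noteq> 0\<close>;
  for \<open>d0 = 0\<close> they force \<open>d1 = 0\<close> and
  \<open>\<alpha> = - e0 / e1\<close>, and \<open>a\<close> is free.\<close>

lemma count_block4:
  fixes x y :: "'p::prime_card point"
  assumes "x \<noteq> y"
  shows "card {s \<in> {(\<alpha>, \<beta>, a, b). \<alpha> \<noteq> 0}. x \<in> (\<lambda>(\<alpha>, \<beta>, a, b). block4 \<alpha> \<beta> a b) s \<and> y \<in> (\<lambda>(\<alpha>, \<beta>, a, b). block4 \<alpha> \<beta> a b) s} =
    (if fst x $ 1 = fst y $ 1 then
       if fst x $ 2 = fst y $ 2 \<and> snd x $ 1 \<noteq> snd y $ 1 \<and> snd x $ 2 \<noteq> snd y $ 2 then CARD('p) else 0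
     else if fst x $ 2 = fst y $ 2 then 0 else 1)"
    (is "card ?X = _")
proof -
  define d0 d1 e0 e1 where d: "d0 = fst x $ 1 - fst y $ 1" "d1 = fst x $ 2 - fst y $ 2"
    "e0 = snd x $ 1 - snd y $ 1" "e1 = snd x $ 2 - snd y $ 2"
  let ?Y = "{(\<alpha>, a). \<alpha> \<noteq> 0 \<and> d1 = \<alpha> * d0 \<and> e1 = (- 1 / \<alpha>) * e0 + a * d0}"
  let ?f = "\<lambda>(\<alpha>, a). (\<alpha>, fst x $ 2 - \<alpha> * fst x $ 1, a, snd x $ 2 - (- 1 / \<alpha>) * snd x $ 1 - a * fst x $ 1)"
  \<comment> \<open>Two affine equations with the same constant term amount to their difference
    together with a formula for that term.\<close>
  have lin: "(m = c * s + t \<and> m' = c * s' + t) \<longleftrightarrow> (m - m' = c * (s - s') \<and> t = m - c * s)" for m m' c s s' t :: "'p mod_ring"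
    by (auto simp: algebra_simps)
  have lin2: "(m = c * s + a * u + t \<and> m' = c * s' + a * u' + t) \<longleftrightarrow>
      (m - m' = c * (s - s') + a * (u - u') \<and> t = m - c * s - a * u)" for m m' c s s' t a u u' :: "'p mod_ring"
    by (auto simp: algebra_simps)
  have "(\<alpha>, \<beta>, a, b) \<in> ?X \<longleftrightarrow> \<alpha> \<noteq> 0 \<and> (fst x $ 2 = \<alpha> * fst x $ 1 + \<beta> \<and> fst y $ 2 = \<alpha> * fst y $ 1 + \<beta>)
    \<and> (snd x $ 2 = (- 1 / \<alpha>) * snd x $ 1 + a * fst x $ 1 + b \<and> snd y $ 2 = (- 1 / \<alpha>) * snd y $ 1 + a * fst y $ 1 + b)" for \<alpha> \<beta> a b
    by (auto simp: block4_def)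
  then have mem: "(\<alpha>, \<beta>, a, b) \<in> ?X \<longleftrightarrow> (\<alpha>, a) \<in> ?Y \<and> \<beta> = fst x $ 2 - \<alpha> * fst x $ 1
    \<and> b = snd x $ 2 - (- 1 / \<alpha>) * snd x $ 1 - a * fst x $ 1" for \<alpha> \<beta> a b
    unfolding lin lin2 d[symmetric] by blast
  have X: "?X = ?f ` ?Y"
  proof (intro equalityI subsetI)
    fix s assume s: "s \<in> ?X"
    obtain \<alpha> \<beta> a b where eq: "s = (\<alpha>, \<beta>, a, b)" by (cases s)
    have "(\<alpha>, a) \<in> ?Y" "s = ?f (\<alpha>, a)" using s unfolding eq mem by simp_all
    then show "s \<in> ?f ` ?Y" by (rule rev_image_eqI)
  next
    fix s assume "s \<in> ?f ` ?Y"
    then obtain t where t: "t \<in> ?Y" "s = ?f t" by (elim imageE)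
    obtain \<alpha> a where eq: "t = (\<alpha>, a)" by (cases t)
    show "s \<in> ?X" unfolding t(2) eq prod.case mem using t(1) unfolding eq by blast
  qed
  have s1: "card ?X = card ?Y" unfolding X by (rule card_image) (auto simp: inj_on_def)
  have s2: "card ?Y = (if d0 = 0 then if d1 = 0 \<and> e0 \<noteq> 0 \<and> e1 \<noteq> 0 then CARD('p) else 0 else if d1 = 0 then 0 else 1)"
  proof (cases "d0 = 0")
    case True
    show ?thesis
    proof (cases "d1 = 0 \<and> e0 \<noteq> 0 \<and> e1 \<noteq> 0")
      case t: True
      have "?Y = {- e0 / e1} \<times> UNIV" using True t by (auto simp: field_simps)
      then show ?thesis using True t by (simp add: card_cartesian_product)
    next
      case f: False
      have "\<not> (d0 = 0 \<and> d1 = 0 \<and> e0 = 0 \<and> e1 = 0)" using assms unfolding d pt_eq_iff by simp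
      then have "?Y = {}" using True f by auto
      then have "card ?Y = 0" by (simp only: card.empty)
      show ?thesis unfolding \<open>card ?Y = 0\<close> using True f by simp
    qed
  next
    case False
    show ?thesis
    proof (cases "d1 = 0")
      case t: True
      then have "?Y = {}" using False by auto
      then have "card ?Y = 0" by (simp only: card.empty)
      show ?thesis unfolding \<open>card ?Y = 0\<close> using False t by simp
    next
      case f: False
      have "?Y = {(d1 / d0, (e1 - (- 1 / (d1 / d0)) * e0) / d0)}"
      proof (intro equalityI subsetI)
        fix s assume s: "s \<in> ?Y"
        obtain \<alpha> a where eq: "s = (\<alpha>, a)" by (cases s)
        have Y: "d1 = \<alpha> * d0" "e1 = (- 1 / \<alpha>) * e0 + a * d0" using s unfolding eq by blast+
        have \<alpha>: "\<alpha> = d1 / d0" using False unfolding Y(1) by simp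
        have "a = (e1 - (- 1 / \<alpha>) * e0) / d0" using False unfolding Y(2) by simp
        then show "s \<in> {(d1 / d0, (e1 - (- 1 / (d1 / d0)) * e0) / d0)}" unfolding eq \<alpha> by simp
      qed (use False f in simp)
      then have "card ?Y = 1" by simp
      show ?thesis unfolding \<open>card ?Y = 1\<close> using False f by simp
    qed
  qed
  from trans[OF s1 s2] show ?thesis unfolding d right_minus_eq .
qed

text \<open>If the first components agree, \<open>\<B>0\<close> contributes 1 and exactly one of
  \<open>\<B>2\<close>, \<open>\<B>3\<close>, \<open>\<B>4\<close> contributes \<open>p\<close>,
  depending on which coordinates of the second components agree. If they differ,
  \<open>\<B>1\<close> contributes \<open>p\<close> and exactly one of these three contributes 1,
  depending on the direction of the difference.\<close>

lemma AG_tilde_balanced: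
  fixes x y :: "'p::prime_card point"
  assumes "x \<noteq> y"
  shows "size {#\<beta> \<in># AG_tilde. x \<in> \<beta> \<and> y \<in> \<beta>#} = CARD('p) + 1"
proof -
  have "fst x $ 1 = fst y $ 1 \<and> fst x $ 2 = fst y $ 2 \<Longrightarrow> \<not> (snd x $ 1 = snd y $ 1 \<and> snd x $ 2 = snd y $ 2)"
    using assms unfolding pt_eq_iff by blast
  moreover have "fst x = fst y \<longleftrightarrow> fst x $ 1 = fst y $ 1 \<and> fst x $ 2 = fst y $ 2"
    by (simp add: vec_eq_iff forall_2)
  ultimately show ?thesis
    unfolding AG_tilde_def B0_eq B1_eq B2_eq B3_eq B4_eq filter_union_mset size_union
    by (simp only: size_filter_image finite count_block0 count_block1[OF assms] count_block4[OF assms])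
      (simp add: count_block0 count_block2 count_block3, blast)
qed

section \<open>Parameters, simplicity, intersections and parallel classes of the design\<close>

definition AG_set :: "'p::prime_card point set set" where
  "AG_set = range block0 \<union> (\<lambda>(A, b). block1 A b) ` (Sym2 \<times> UNIV) \<union> range (\<lambda>(a, b, c). block2 a b c)
    \<union> range (\<lambda>(a, b, c). block3 a b c) \<union> (\<lambda>(\<alpha>, \<beta>, a, b). block4 \<alpha> \<beta> a b) ` {(\<alpha>, \<beta>, a, b). \<alpha> \<noteq> 0}"

lemma AG_tilde_eq: "(AG_tilde :: 'p::prime_card point blocks) = mset_set AG_set"
proof -
  let ?R0 = "range block0 :: 'p point set set" and ?R1 = "(\<lambda>(A, b). block1 A b) ` (Sym2 \<times> UNIV) :: 'p point set set"
    and ?R2 = "range (\<lambda>(a, b, c). block2 a b c) :: 'p point set set"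
    and ?R3 = "range (\<lambda>(a, b, c). block3 a b c) :: 'p point set set"
    and ?R4 = "(\<lambda>(\<alpha>, \<beta>, a, b). block4 \<alpha> \<beta> a b) ` {(\<alpha>, \<beta>, a, b). \<alpha> \<noteq> 0} :: 'p point set set"
  have dis: "?R0 \<inter> ?R1 = {}" "(?R0 \<union> ?R1) \<inter> ?R2 = {}" "(?R0 \<union> ?R1 \<union> ?R2) \<inter> ?R3 = {}"
    "(?R0 \<union> ?R1 \<union> ?R2 \<union> ?R3) \<inter> ?R4 = {}"
    by (auto simp: blocks_distinct blocks_distinct[THEN not_sym])
  have "AG_tilde = mset_set ?R0 + mset_set ?R1 + mset_set ?R2 + mset_set ?R3 + mset_set ?R4"
    unfolding AG_tilde_def B0_eq B1_eq B2_eq B3_eq B4_eq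
    by (simp only: image_mset_mset_set inj_block0 inj_on_subset[OF inj_block1 subset_UNIV] inj_block2 inj_block3
        inj_on_subset[OF inj_block4 subset_UNIV])
  also have "\<dots> = mset_set AG_set"
    unfolding AG_set_def by (simp only: mset_set_Union finite dis)
  finally show ?thesis .
qed

text \<open>The link to spreads: a block is a coset of a Lagrangian plane, and a block through
  \<open>0\<close> is such a plane.\<close>

lemma AG_set_direction:
  assumes "\<beta> \<in> AG_set" "z \<in> \<beta>"
  shows "lagrangian {w. w + z \<in> \<beta>}"
  using assms unfolding AG_set_def
  by (auto intro: lagrangian_block0 lagrangian_block1 lagrangian_block2 lagrangian_block3 lagrangian_block4 simp: Sym2_iff)

lemma AG_set_nonempty:
  assumes "\<beta> \<in> AG_set"
  shows "\<beta> \<noteq> {}"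
  using assms unfolding AG_set_def by (auto simp: block_nonempty block_nonempty[THEN not_sym])

lemma card_translate:
  fixes \<beta> :: "'a::ab_group_add set"
  shows "card {w. w + z \<in> \<beta>} = card \<beta>"
proof -
  have "bij_betw (\<lambda>w. w + z) {w. w + z \<in> \<beta>} \<beta>"
    by (rule bij_betwI[where g = "\<lambda>w. w - z"]) auto
  then show ?thesis by (rule bij_betw_same_card)
qed

lemma card_AG_set:
  fixes \<beta> :: "'p::prime_card point set"
  assumes "\<beta> \<in> AG_set"
  shows "card \<beta> = CARD('p) ^ 2"
proof -
  obtain z where "z \<in> \<beta>" using AG_set_nonempty[OF assms] by blast
  from card_lagrangian[OF AG_set_direction[OF assms this]] show ?thesis unfolding card_translate by simp
qed

text \<open>Moved to a common point, two blocks become subgroups of order \<open>p\<^sup>2\<close>,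
  and the order of their intersection divides \<open>p\<^sup>2\<close>.\<close>

lemma AG_set_inter:
  fixes \<beta> \<beta>' :: "'p::prime_card point set"
  assumes "\<beta> \<in> AG_set" "\<beta>' \<in> AG_set"
  shows "card (\<beta> \<inter> \<beta>') \<in> {CARD('p) ^ 2, CARD('p), 1, 0}"
proof (cases "\<beta> \<inter> \<beta>' = {}")
  case True
  then show ?thesis by simp
next
  case False
  then obtain z where z: "z \<in> \<beta>" "z \<in> \<beta>'" by blast
  let ?L = "{w. w + z \<in> \<beta>}" and ?M = "{w. w + z \<in> \<beta>'}"
  have L: "lagrangian ?L" and M: "lagrangian ?M" using AG_set_direction assms z by blast+
  have "card (?L \<inter> ?M) dvd CARD('p mod_ring) ^ 2"
    by (rule card_lagrangian_inter_dvd[OF L lagrangian_zero[OF M] lagrangian_diff[OF M]])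
  moreover have "?L \<inter> ?M = {w. w + z \<in> \<beta> \<inter> \<beta>'}" by blast
  ultimately have "card (\<beta> \<inter> \<beta>') dvd CARD('p) ^ 2" by (simp only: card_translate CARD_mod_ring)
  then obtain i where "i \<le> 2" "card (\<beta> \<inter> \<beta>') = CARD('p) ^ i"
    using divides_primepow_nat[OF prime_card] by blast
  moreover have "i = 0 \<or> i = 1 \<or> i = 2" using \<open>i \<le> 2\<close> by linarith
  ultimately show ?thesis by auto
qed

lemma in_AG_tilde: "\<beta> \<in># AG_tilde \<longleftrightarrow> \<beta> \<in> AG_set"
  by (simp add: AG_tilde_eq)

lemma AG_tilde_bibd: "bibd (CARD('p) ^ 4) (CARD('p) ^ 2) (CARD('p) + 1) UNIV (AG_tilde :: 'p::prime_card point blocks)"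
proof -
  have "CARD('p point) = CARD('p) ^ 4" using CARD_pt[where 'a = "'p mod_ring"] by (simp only: CARD_mod_ring)
  then show ?thesis
    unfolding bibd_def by (intro conjI ballI impI finite subset_UNIV card_AG_set AG_tilde_balanced)
      (simp_all only: in_AG_tilde not_False_eq_True)
qed

lemma AG_tilde_simple: "simple_design AG_tilde"
  unfolding simple_design_def AG_tilde_eq by simp

lemma AG_tilde_not_affine: "\<not> affine_design UNIV (AG_tilde :: 'p::prime_card point blocks)"
proof
  assume "affine_design UNIV (AG_tilde :: 'p point blocks)"
  then obtain n :: nat and C \<mu> where "(AG_tilde :: 'p point blocks) = (\<Sum>i<n. mset_set (C i)) \<and>
      (\<forall>i<n. partition_on UNIV (C i)) \<and>
      (\<forall>i<n. \<forall>j<n. i \<noteq> j \<longrightarrow> (\<forall>\<beta>\<in>C i. \<forall>\<beta>'\<in>C j. card (\<beta> \<inter> \<beta>') = \<mu>))"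
    unfolding affine_design_def by (elim exE)
  then have C: "(AG_tilde :: 'p point blocks) = (\<Sum>i<n. mset_set (C i))"
      "\<And>i. i < n \<Longrightarrow> partition_on UNIV (C i)"
      "\<And>i j \<beta> \<beta>'. i < n \<Longrightarrow> j < n \<Longrightarrow> i \<noteq> j \<Longrightarrow> \<beta> \<in> C i \<Longrightarrow> \<beta>' \<in> C j \<Longrightarrow> card (\<beta> \<inter> \<beta>') = \<mu>"
    by blast+
  have class_ex: "\<exists>i<n. \<beta> \<in> C i" if "\<beta> \<in> AG_set" for \<beta> :: "'p point set"
  proof -
    have "\<beta> \<in># (\<Sum>i<n. mset_set (C i))" using that unfolding C(1)[symmetric] in_AG_tilde .
    then obtain i where "i < n" "\<beta> \<in># mset_set (C i)" by (auto simp: set_mset_sum)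
    then show ?thesis by auto
  qed
  \<comment> \<open>Distinct blocks with a common point cannot lie in one parallel class, so they
    must meet in \<open>\<mu>\<close> points.\<close>
  have meet: "card (\<beta> \<inter> \<beta>') = \<mu>" if "\<beta> \<in> AG_set" "\<beta>' \<in> AG_set" "\<beta> \<noteq> \<beta>'" "0 \<in> \<beta>" "0 \<in> \<beta>'"
    for \<beta> \<beta>' :: "'p point set"
  proof -
    from class_ex[OF that(1)] class_ex[OF that(2)]
    obtain i j where ij: "i < n" "\<beta> \<in> C i" "j < n" "\<beta>' \<in> C j" by blast
    have "i \<noteq> j"
    proof
      assume "i = j"
      then have "\<beta> \<inter> \<beta>' = {}"
        using partition_onD2[OF C(2)[OF ij(1)]] ij that(3) unfolding disjoint_def by blast
      then show False using that(4,5) by blast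
    qed
    then show ?thesis using C(3) ij by blast
  qed
  \<comment> \<open>Three blocks through \<open>0\<close>: the first meets the second in one point
    and the third in \<open>p\<close> points, so no single \<open>\<mu>\<close> fits.\<close>
  let ?b0 = "block0 0 :: 'p point set" and ?b1 = "block1 0 0 :: 'p point set" and ?b2 = "block2 0 0 0 :: 'p point set"
  have "(0 :: 'p mod_ring ^ 2 ^ 2) \<in> Sym2" by (simp add: Sym2_iff)
  then have "?b1 \<in> (\<lambda>(A, b). block1 A b) ` (Sym2 \<times> UNIV)"
    by (intro image_eqI[where x = "(0, 0)"]) simp_all
  moreover have "?b2 \<in> range (\<lambda>(a, b, c). block2 a b c)"
    by (rule range_eqI[where x = "(0, 0, 0)"]) simp
  moreover have "?b0 \<in> range block0" by (rule rangeI)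
  ultimately have b: "?b0 \<in> AG_set" "?b1 \<in> AG_set" "?b2 \<in> AG_set"
    unfolding AG_set_def by (simp_all only: Un_iff simp_thms)
  have zero: "0 \<in> ?b0" "0 \<in> ?b1" "0 \<in> ?b2" by (simp_all add: block_defs)
  have "?b0 \<inter> ?b1 = {0}" by (auto simp: block0_def block1_def prod_eq_iff)
  then have "\<mu> = 1" using meet[OF b(1,2) blocks_distinct(1) zero(1,2)] by simp
  moreover have "card (?b0 \<inter> ?b2) = CARD('p)"
  proof -
    have "bij_betw (\<lambda>t. (0, vector [t, 0])) (UNIV :: 'p mod_ring set) (?b0 \<inter> ?b2)"
      by (rule bij_betwI[where g = "\<lambda>x. snd x $ 1"]) (auto simp: block0_def block2_def pt_eq_iff)
    from bij_betw_same_card[OF this] show ?thesis by simp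
  qed
  then have "\<mu> = CARD('p)" using meet[OF b(1,3) blocks_distinct(2) zero(1,3)] by simp
  ultimately show False using prime_card[where 'a = 'p] by simp
qed

section \<open>Copies of the affine plane inside the design\<close>

lemma AG2_unique_line:
  fixes P Q :: "'q::{field,finite} \<times> 'q"
  assumes "P \<noteq> Q"
  shows "size {#\<beta> \<in># AG2. P \<in> \<beta> \<and> Q \<in> \<beta>#} = 1"
proof -
  let ?line = "\<lambda>x y u v :: 'q. range (\<lambda>t. (x + t * u, y + t * v))"
  let ?Lines = "{?line x y u v | x y u v. (u, v) \<noteq> (0, 0)}"
  obtain a b c d where PQ: "P = (a, b)" "Q = (c, d)" by (cases P, cases Q)
  let ?l = "?line a b (c - a) (d - b)"
  have "{\<beta> \<in> ?Lines. P \<in> \<beta> \<and> Q \<in> \<beta>} = {?l}"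
  proof (intro equalityI subsetI)
    fix \<beta> assume "\<beta> \<in> {\<beta> \<in> ?Lines. P \<in> \<beta> \<and> Q \<in> \<beta>}"
    then have mem: "\<beta> \<in> ?Lines" "P \<in> \<beta>" "Q \<in> \<beta>" by blast+
    from mem(1) obtain x y u v where \<beta>: "\<beta> = ?line x y u v" by blast
    from mem(2) obtain s where "P = (x + s * u, y + s * v)" unfolding \<beta> by blast
    then have s: "a = x + s * u" "b = y + s * v" unfolding PQ by simp_all
    from mem(3) obtain t where "Q = (x + t * u, y + t * v)" unfolding \<beta> by blast
    then have t: "c = x + t * u" "d = y + t * v" unfolding PQ by simp_all
    have "t \<noteq> s" using assms unfolding PQ s t by auto
    then have ts: "t - s \<noteq> 0" by simp
    have "?l = \<beta>"
    proof (intro equalityI subsetI)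
      fix z assume "z \<in> ?l"
      then obtain r where "z = (a + r * (c - a), b + r * (d - b))" by blast
      then have "z = (x + (s + r * (t - s)) * u, y + (s + r * (t - s)) * v)"
        unfolding s t by (simp add: algebra_simps)
      then show "z \<in> \<beta>" unfolding \<beta> by blast
    next
      fix z assume "z \<in> \<beta>"
      then obtain r where z: "z = (x + r * u, y + r * v)" unfolding \<beta> by blast
      \<comment> \<open>The affine change of parameter that sends \<open>s\<close>, the parameter of
        \<open>P\<close>, to 0 and \<open>t\<close>, that of \<open>Q\<close>, to 1.\<close>
      define w where "w = (r - s) / (t - s)"
      have r: "r = s + w * (t - s)" using ts unfolding w_def by simp
      have "z = (a + w * (c - a), b + w * (d - b))"
        unfolding z r s t by (simp add: algebra_simps)
      then show "z \<in> ?l" by blast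
    qed
    then show "\<beta> \<in> {?l}" by simp
  next
    fix \<beta> assume "\<beta> \<in> {?l}"
    then have \<beta>: "\<beta> = ?l" by simp
    have "(c - a, d - b) \<noteq> (0, 0)" using assms unfolding PQ by auto
    then have "\<beta> \<in> ?Lines" unfolding \<beta> by blast
    moreover have "P = (a + 0 * (c - a), b + 0 * (d - b))" "Q = (a + 1 * (c - a), b + 1 * (d - b))"
      unfolding PQ by simp_all
    then have "P \<in> \<beta>" "Q \<in> \<beta>" unfolding \<beta> by blast+
    ultimately show "\<beta> \<in> {\<beta> \<in> ?Lines. P \<in> \<beta> \<and> Q \<in> \<beta>}" by blast
  qed
  moreover have "size {#\<beta> \<in># AG2. P \<in> \<beta> \<and> Q \<in> \<beta>#} = card {\<beta> \<in> ?Lines. P \<in> \<beta> \<and> Q \<in> \<beta>}"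
    unfolding AG2_def by (simp only: filter_mset_mset_set finite size_mset_set)
  ultimately show ?thesis by simp
qed

lemma design_iso_AG2_unique_block:
  assumes "design_iso UNIV D UNIV (AG2 :: ('q::{field,finite} \<times> 'q) blocks)" "x \<noteq> y"
  shows "size {#\<beta> \<in># D. x \<in> \<beta> \<and> y \<in> \<beta>#} = 1"
proof -
  obtain f :: "_ \<Rightarrow> 'q \<times> 'q" where f: "bij f" "image_mset ((`) f) D = AG2" using assms(1) unfolding design_iso_def by blast
  have inj: "inj f" using f(1) by (rule bij_is_inj)
  then have "f x \<noteq> f y" using assms(2) by (simp add: inj_eq)
  from AG2_unique_line[OF this]
  have "size (filter_mset (\<lambda>\<beta>. f x \<in> \<beta> \<and> f y \<in> \<beta>) (image_mset ((`) f) D)) = 1" unfolding f(2) .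
  then show ?thesis by (simp add: filter_mset_image_mset inj_image_mem_iff[OF inj])
qed

text \<open>Each nonzero point is joined to \<open>0\<close> by exactly one line of the copy, and
  the blocks through \<open>0\<close> are Lagrangian planes.\<close>

lemma spread_of_AG2_copy:
  fixes D :: "'p::prime_card point blocks"
  assumes "design_iso UNIV D UNIV (AG2 :: ('q::{field,finite} \<times> 'q) blocks)" "D \<subseteq># AG_tilde"
  shows "spread {\<beta> \<in> set_mset D. 0 \<in> \<beta>}"
  unfolding spread_def
proof (intro conjI ballI allI impI)
  fix L assume L: "L \<in> {\<beta> \<in> set_mset D. 0 \<in> \<beta>}"
  then have "L \<in> AG_set" using mset_subset_eqD[OF assms(2)] in_AG_tilde by blast
  from AG_set_direction[OF this, of 0] L show "lagrangian L" by simp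
next
  fix x :: "'p point" assume "x \<noteq> 0"
  then have "size {#\<beta> \<in># D. 0 \<in> \<beta> \<and> x \<in> \<beta>#} = 1" using design_iso_AG2_unique_block[OF assms(1)] by metis
  then obtain L where "{#\<beta> \<in># D. 0 \<in> \<beta> \<and> x \<in> \<beta>#} = {#L#}" using size_1_singleton_mset by blast
  then have "set_mset {#\<beta> \<in># D. 0 \<in> \<beta> \<and> x \<in> \<beta>#} = {L}" by simp
  then have "{\<beta> \<in> set_mset D. 0 \<in> \<beta> \<and> x \<in> \<beta>} = {L}" by (simp only: set_mset_filter)
  then show "\<exists>!L. L \<in> {\<beta> \<in> set_mset D. 0 \<in> \<beta>} \<and> x \<in> L" by (intro ex1I[of _ L]) blast+
qed

text \<open>Two of the copies already conflict: their spreads at \<open>0\<close> share a plane,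
  which would then occur at least twice in a design without repeated blocks.\<close>

lemma AG_tilde_not_decomposable:
  assumes "odd CARD('p)" "2 \<le> n"
  shows "\<not> decomposes_into_copies UNIV (AG_tilde :: 'p::prime_card point blocks) n
    UNIV (AG2 :: ('q::{field,finite} \<times> 'q) blocks)"
proof
  assume "decomposes_into_copies UNIV (AG_tilde :: 'p point blocks) n UNIV (AG2 :: ('q \<times> 'q) blocks)"
  then obtain D where D: "(AG_tilde :: 'p point blocks) = (\<Sum>i<n. D i)"
      "\<And>i. i < n \<Longrightarrow> design_iso UNIV (D i) UNIV (AG2 :: ('q \<times> 'q) blocks)"
    unfolding decomposes_into_copies_def by blast
  have "{..<n} = {0, 1} \<union> {2..<n}" using assms(2) by auto
  then have "(\<Sum>i<n. D i) = (\<Sum>i\<in>{0, 1}. D i) + (\<Sum>i\<in>{2..<n}. D i)"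
    by (simp only:) (rule sum.union_disjoint, auto)
  then have split: "AG_tilde = D 0 + D 1 + (\<Sum>i\<in>{2..<n}. D i)" unfolding D(1) by simp
  have "spread {\<beta> \<in> set_mset (D 0). 0 \<in> \<beta>}"
    by (rule spread_of_AG2_copy[OF D(2)]) (use assms(2) split in \<open>auto simp: subset_mset.le_iff_add add.assoc\<close>)
  moreover have "spread {\<beta> \<in> set_mset (D 1). 0 \<in> \<beta>}"
  proof (rule spread_of_AG2_copy[OF D(2)])
    have "AG_tilde = D 1 + (D 0 + (\<Sum>i\<in>{2..<n}. D i))" unfolding split by (simp add: ac_simps)
    then show "D 1 \<subseteq># AG_tilde" unfolding subset_mset.le_iff_add by blast
  qed (use assms(2) in simp)
  ultimately have "{\<beta> \<in> set_mset (D 0). 0 \<in> \<beta>} \<inter> {\<beta> \<in> set_mset (D 1). 0 \<in> \<beta>} \<noteq> {}"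
    by (rule spreads_meet) (use assms(1) in simp)
  then obtain L where L: "L \<in># D 0" "L \<in># D 1" by blast
  have "count AG_tilde L \<ge> count (D 0) L + count (D 1) L" unfolding split by simp
  moreover have "count (D 0) L \<ge> 1" "count (D 1) L \<ge> 1" using L by (simp_all add: Suc_le_eq)
  moreover have "count AG_tilde L \<le> 1" unfolding AG_tilde_eq by (simp add: count_mset_set')
  ultimately show False by linarith
qed

theorem theorem5p9:
  fixes p :: nat
  assumes "CARD('p::prime_card) = p" and "odd p"
    and "CARD('q::{field,finite}) = p ^ 2"
  shows "is_bibd UNIV (AG_tilde :: 'p point blocks)
    \<and> simple_design (AG_tilde :: 'p point blocks)
    \<and> \<not> affine_design UNIV (AG_tilde :: 'p point blocks)
    \<and> \<not> decomposes_into_copies UNIV (AG_tilde :: 'p point blocks) (p + 1)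
          UNIV (AG2 :: ('q \<times> 'q) blocks)
    \<and> (\<forall>\<beta> \<in># (AG_tilde :: 'p point blocks). \<forall>\<beta>' \<in># (AG_tilde :: 'p point blocks).
          card (\<beta> \<inter> \<beta>') \<in> {p ^ 2, p, 1, 0})"
proof (intro conjI ballI)
  show "is_bibd UNIV (AG_tilde :: 'p point blocks)" unfolding is_bibd_def using AG_tilde_bibd by blast
  show "simple_design (AG_tilde :: 'p point blocks)" by (rule AG_tilde_simple)
  show "\<not> affine_design UNIV (AG_tilde :: 'p point blocks)" by (rule AG_tilde_not_affine)
  have "odd CARD('p)" "2 \<le> p + 1"
    using assms prime_gt_1_nat[OF prime_card[where 'a = 'p]] by simp_all
  then show "\<not> decomposes_into_copies UNIV (AG_tilde :: 'p point blocks) (p + 1) UNIV (AG2 :: ('q \<times> 'q) blocks)"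
    by (rule AG_tilde_not_decomposable)
  fix \<beta> \<beta>' :: "'p point set" assume "\<beta> \<in># AG_tilde" "\<beta>' \<in># AG_tilde"
  then show "card (\<beta> \<inter> \<beta>') \<in> {p ^ 2, p, 1, 0}"
    using AG_set_inter[of \<beta> \<beta>'] unfolding in_AG_tilde assms(1) by blast
qed

end
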